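(* Let $1<p<\infty$. Let $H_1,H_2\subset\mathbb{C}$ be two half planes such that $\Sigma:=H_1\cap H_2\neq\emptyset$ is a sector. Then $$A^p(\Sigma)=A^p(H_1)+A^p(H_2).$$
   Context: For an open set $\Omega\subset\mathbb{C}$ and $1\le p<\infty$, the Bergman space $A^p(\Omega)$ consists of all holomorphic functions $f$ on $\Omega$ with $\int_\Omega |f(x+iy)|^p\,dx\,dy<+\infty$. Half planes are open half planes of $\mathbb{C}$ (bounded by arbitrary real lines). A sector (arising as the intersection of two half planes) is the image under a translation and a rotation of $\{z\in\mathbb{C}:0<\arg(z)<\theta\}$ for some $0<\theta<\pi$. The sum $A^p(H_1)+A^p(H_2)$ is the set of functions on $\Sigma$ of the form $f_1|_\Sigma+f_2|_\Sigma$ with $f_i\in A^p(H_i)$. *)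

theory Defs
  imports "HOL-Analysis.Analysis"
begin

text \<open>
  A function on an open set \<open>\<Omega>\<close> is represented by an extensional total function, i.e. one with the
  value \<^term>\<open>undefined\<close> outside \<open>\<Omega>\<close>, so that equality in HOL is equality of functions on \<open>\<Omega>\<close>.
  The measure \<open>lborel\<close> on \<^typ>\<open>complex\<close> is the planar Lebesgue measure \<open>dx dy\<close>. The definition is
  only meant for open \<open>\<Omega>\<close> and \<open>1 \<le> p\<close>.
\<close>

definition bergman :: "real \<Rightarrow> complex set \<Rightarrow> (complex \<Rightarrow> complex) set" where
  "bergman p \<Omega> =
     {f \<in> extensional \<Omega>. f holomorphic_on \<Omega> \<and> set_integrable lborel \<Omega> (\<lambda>z. norm (f z) powr p)}"

definition half_plane :: "complex set \<Rightarrow> bool" where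
  "half_plane H \<longleftrightarrow> (\<exists>a b. a \<noteq> 0 \<and> H = {z. a \<bullet> z > b})"

text \<open>
  The library's \<^term>\<open>Arg\<close> takes values in \<open>(-\<pi>, \<pi>]\<close> and \<open>Arg 0 = 0\<close>, so the apex is
  excluded from the sector.
\<close>

definition sector :: "complex set \<Rightarrow> bool" where
  "sector S \<longleftrightarrow> (\<exists>c \<phi> \<theta>. 0 < \<theta> \<and> \<theta> < pi \<and>
     S = (\<lambda>z. c + cis \<phi> * z) ` {z. 0 < Arg z \<and> Arg z < \<theta>})"

end

theory Submission
  imports Defs "HOL-Complex_Analysis.Complex_Analysis"
begin

text \<open>
  Let the sector be \<open>\<alpha> < arg z < \<beta>\<close> and fix two rays \<open>R\<^sub>1\<close>, \<open>R\<^sub>2\<close> inside it, of angles \<open>\<alpha>\<^sub>1 < \<alpha>\<^sub>2\<close>.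
  With \<open>I\<^sub>j(z)\<close> the integral of \<open>f(w) (1/(w - z) + 1/(w + z)) / (2\<pi>i)\<close> along \<open>R\<^sub>j\<close>, Cauchy's formula
  gives \<open>f = I\<^sub>1 - I\<^sub>2\<close> between the rays. The reflected pole \<open>- z\<close> lies outside the sector and
  improves the decay of the kernel, so that the integrals converge for every \<open>p > 1\<close>. Now \<open>I\<^sub>1\<close> is
  holomorphic on \<open>\<alpha>\<^sub>1 < arg z < \<alpha> + \<pi>\<close> and is continued by \<open>f + I\<^sub>2\<close> to the rest of the half plane
  \<open>\<alpha> < arg z < \<alpha> + \<pi>\<close>; likewise \<open>- I\<^sub>2\<close> is continued by \<open>f - I\<^sub>1\<close>.

  Each continuation can be estimated with a ray at a positive angle from \<open>z\<close>, so no singular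
  integral occurs: by the mean value property \<open>|I\<^sub>j(z)|\<close> is at most a constant times the integral of
  \<open>|f(w)| / (|w| + |z|)\<^sup>2\<close> over the sector, and this positive operator is bounded on \<open>L\<^sup>p\<close> by
  Schur's test with powers of \<open>|w|\<close>.
\<close>

subsection \<open>Integral inequalities\<close>

text \<open>The obstacle is convergence at the apex. Along a ray inside the sector a Bergman
  function is only known to be \<open>O(|w|^(-2/p))\<close>. In the variable
  \<open>t = ln |w|\<close> the plain Cauchy kernel becomes \<open>w / (w - z)\<close>, which
  vanishes only to first order at \<open>w = 0\<close>, so that this growth bound gives convergence
  only for \<open>p > 2\<close>. With the pole at \<open>- z\<close> added the kernel is
  \<open>2 w^2 / (w^2 - z^2)\<close>, of second order at 0 and bounded at infinity; the rates at the
  two ends are then \<open>2 - 2/p\<close> and \<open>2/p\<close>, both positive exactly for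
  \<open>p > 1\<close>. The same change makes the area kernel \<open>1 / (|w| + |z|)^2\<close>
  instead of \<open>1 / (|w| (|w| + |z|))\<close>, without singularity at \<open>w = 0\<close>.

  Two rays are needed because the line between them then serves as a seam: on either side of it the
  formula in use involves a ray at a fixed angular distance. Everything is written in
  \<open>\<omega>\<close> with \<open>w = exp \<omega>\<close>: rays become horizontal lines,
  sectors strips, dilations translations, and angles beyond the principal branch cause no
  trouble.\<close>

lemma nn_integral_exp_abs_le:
  assumes "0 < a"
  shows "(\<integral>\<^sup>+t. ennreal (exp (- a * \<bar>t - u\<bar>)) \<partial>lborel) \<le> ennreal (2 / a)"
proof -
  have half: "(\<integral>\<^sup>+t. ennreal (exp (- a * t)) * indicator {0..} t \<partial>lborel) = ennreal (1 / a)"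
  proof -
    have "((\<lambda>t. exp (- a * t)) \<longlongrightarrow> 0) at_top"
      using assms by real_asymp
    then have "((\<lambda>t. - exp (- a * t) / a) \<longlongrightarrow> 0) at_top"
      using tendsto_divide[OF tendsto_minus, of "\<lambda>t. exp (- a * t)" 0 at_top "\<lambda>_. a" a] assms by simp
    then have "(\<integral>\<^sup>+t. ennreal (exp (- a * t)) * indicator {0..} t \<partial>lborel)
        = ennreal (0 - (- exp (- a * 0) / a))"
      using assms
      by (intro nn_integral_FTC_atLeast) (auto intro!: derivative_eq_intros simp: field_simps)
    then show ?thesis by simp
  qed
  have "(\<integral>\<^sup>+t. ennreal (exp (- a * \<bar>t - u\<bar>)) \<partial>lborel) = (\<integral>\<^sup>+t. ennreal (exp (- a * \<bar>t\<bar>)) \<partial>lborel)"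
    by (subst nn_integral_real_affine[where c = 1 and t = u]) auto
  also have "\<dots> \<le> (\<integral>\<^sup>+t. ennreal (exp (- a * t)) * indicator {0..} t
      + ennreal (exp (- a * (-t))) * indicator {0..} (-t) \<partial>lborel)"
    by (intro nn_integral_mono) (auto split: split_indicator)
  also have "\<dots> = (\<integral>\<^sup>+t. ennreal (exp (- a * t)) * indicator {0..} t \<partial>lborel)
      + (\<integral>\<^sup>+t. ennreal (exp (- a * (-t))) * indicator {0..} (-t) \<partial>lborel)"
    by (intro nn_integral_add) auto
  also have "(\<integral>\<^sup>+t. ennreal (exp (- a * (-t))) * indicator {0..} (-t) \<partial>lborel)
      = (\<integral>\<^sup>+t. ennreal (exp (- a * t)) * indicator {0..} t \<partial>lborel)"
    by (subst (2) nn_integral_real_affine[where c = "-1" and t = 0]) auto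
  finally show ?thesis
    using assms unfolding half by (simp flip: ennreal_plus)
qed

text \<open>Hoelder's inequality for the measure with density \<open>v\<close>. It serves twice:
  with power weights in Schur's test, and with \<open>v\<close> the indicator of a ball in the
  pointwise growth bound. The real \<open>x\<close> below the integral avoids powers of extended
  reals.\<close>

lemma Holder_weighted:
  fixes u v :: "'a \<Rightarrow> real"
  assumes [measurable]: "u \<in> borel_measurable M" "v \<in> borel_measurable M"
    and u: "\<And>w. 0 \<le> u w" and v: "\<And>w. 0 \<le> v w" and p: "1 < p"
    and V: "(\<integral>\<^sup>+w. ennreal (v w) \<partial>M) \<le> ennreal V" "0 < V"
    and x: "0 \<le> x" "ennreal x \<le> (\<integral>\<^sup>+w. ennreal (u w * v w) \<partial>M)"
  shows "ennreal (x powr p) \<le> ennreal (V powr (p - 1)) * (\<integral>\<^sup>+w. ennreal (u w powr p * v w) \<partial>M)"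
proof (cases "(\<integral>\<^sup>+w. ennreal (u w powr p * v w) \<partial>M)" rule: ennreal_cases)
  case top
  then show ?thesis using V by (simp add: ennreal_mult_top)
next
  case (real B)
  \<comment> \<open>Young's inequality is used as the tangent inequality of \<open>t^p\<close> at
    \<open>m\<close>. The choice \<open>x / V\<close> makes its integrated form collapse to
    \<open>m^p * V <= B\<close>, because then \<open>m^(p - 1) * x = m^p * V\<close>.\<close>
  define m where "m = x / V"
  have m: "0 \<le> m" using V x by (simp add: m_def)
  have young: "p * m powr (p - 1) * t \<le> t powr p + (p - 1) * m powr p" if "0 \<le> t" for t
  proof -
    have "t * m powr (p - 1) \<le> t powr p / p + (m powr (p - 1)) powr (p / (p - 1)) / (p / (p - 1))"
      using p that by (intro Youngs_inequality) (auto simp: field_simps)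
    also have "(m powr (p - 1)) powr (p / (p - 1)) = m powr p"
      using p by (simp add: powr_powr)
    finally show ?thesis using p by (simp add: field_simps)
  qed
  have "ennreal (p * m powr (p - 1) * x) \<le> ennreal (p * m powr (p - 1)) * (\<integral>\<^sup>+w. ennreal (u w * v w) \<partial>M)"
    using x p by (subst ennreal_mult) (auto intro!: mult_left_mono)
  also have "\<dots> = (\<integral>\<^sup>+w. ennreal (p * m powr (p - 1)) * ennreal (u w * v w) \<partial>M)"
    by (subst nn_integral_cmult) auto
  also have "\<dots> \<le> (\<integral>\<^sup>+w. ennreal (u w powr p * v w) + ennreal ((p - 1) * m powr p) * ennreal (v w) \<partial>M)"
  proof (intro nn_integral_mono)
    fix w
    have "p * m powr (p - 1) * (u w * v w) \<le> u w powr p * v w + (p - 1) * m powr p * v w"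
      using mult_right_mono[OF young[OF u] v, of w w] by (simp add: algebra_simps)
    then have "ennreal (p * m powr (p - 1) * (u w * v w))
        \<le> ennreal (u w powr p * v w + (p - 1) * m powr p * v w)"
      by (rule ennreal_leI)
    then show "ennreal (p * m powr (p - 1)) * ennreal (u w * v w)
        \<le> ennreal (u w powr p * v w) + ennreal ((p - 1) * m powr p) * ennreal (v w)"
      using p u v by (simp add: ennreal_mult' ennreal_plus)
  qed
  also have "\<dots> = ennreal B + ennreal ((p - 1) * m powr p) * (\<integral>\<^sup>+w. ennreal (v w) \<partial>M)"
    by (simp add: nn_integral_add nn_integral_cmult real)
  also have "\<dots> \<le> ennreal B + ennreal ((p - 1) * m powr p) * ennreal V"
    by (intro add_left_mono mult_left_mono V) auto
  also have "\<dots> = ennreal (B + (p - 1) * m powr p * V)"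
    using p V real by (simp add: ennreal_mult'' ennreal_plus)
  finally have "p * m powr (p - 1) * x \<le> B + (p - 1) * m powr p * V"
    using p V real by (subst (asm) ennreal_le_iff) auto
  moreover have "m powr (p - 1) * x = m powr p * V"
    using V x by (cases "x = 0") (auto simp: m_def powr_diff)
  ultimately have "m powr p * V \<le> B"
    by (simp add: algebra_simps)
  moreover have "x powr p = V powr (p - 1) * (m powr p * V)"
    using V x by (auto simp: m_def powr_divide powr_diff)
  ultimately have "x powr p \<le> V powr (p - 1) * B"
    by (simp add: mult_left_mono)
  then show ?thesis
    using real by (simp add: ennreal_leI flip: ennreal_mult)
qed

section \<open>Area mean value inequality for holomorphic functions\<close>

lemma nn_integral_translation:
  fixes f :: "'a::euclidean_space \<Rightarrow> ennreal"
  assumes [measurable]: "f \<in> borel_measurable borel"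
  shows "(\<integral>\<^sup>+w. f (c + w) \<partial>lborel) = (\<integral>\<^sup>+w. f w \<partial>lborel)"
proof -
  have "(\<integral>\<^sup>+w. f w \<partial>lborel) = (\<integral>\<^sup>+w. f w \<partial>distr lborel borel ((+) c))"
    by (simp only: lborel_distr_plus)
  also have "\<dots> = (\<integral>\<^sup>+w. f (c + w) \<partial>lborel)"
    by (subst nn_integral_distr) auto
  finally show ?thesis ..
qed

lemma holomorphic_norm_borel_measurable:
  assumes "f holomorphic_on S" "open S"
  shows "(\<lambda>w. norm (f w) * indicator S w) \<in> borel_measurable borel"
proof -
  have "(\<lambda>w. norm (f w)) \<in> borel_measurable (restrict_space borel S)"
    using assms
    by (intro borel_measurable_continuous_on_restrict continuous_intros holomorphic_on_imp_continuous_on)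
  then have "(\<lambda>w. indicator S w *\<^sub>R norm (f w)) \<in> borel_measurable borel"
    using assms by (subst (asm) borel_measurable_restrict_space_iff) auto
  then show ?thesis by (simp add: mult.commute)
qed

lemma emeasure_complex_ball:
  assumes "0 \<le> r"
  shows "emeasure lborel (ball (c::complex) r) = ennreal (pi * r\<^sup>2)"
  using emeasure_ball[of r c] assms by (simp add: unit_ball_vol_2)

text \<open>
  The Cauchy formula on the circles of radius \<open>\<rho>\<close> about \<open>a + s\<close>, averaged over \<open>|s| < \<rho> / 2\<close>:
  this needs only translation invariance, no polar coordinates.
\<close>

lemma holomorphic_norm_le_nn_integral_ball:
  assumes hol: "f holomorphic_on S" and "open S" and sub: "ball a (2 * \<rho>) \<subseteq> S" and \<rho>: "0 < \<rho>"
  shows "ennreal (norm (f a)) * ennreal (\<rho>\<^sup>2)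
    \<le> ennreal 3 * (\<integral>\<^sup>+w. ennreal (norm (f w)) * indicator (ball a (2 * \<rho>)) w \<partial>lborel)"
proof -
  define h where "h w = norm (f w) * indicator (ball a (2 * \<rho>)) w" for w
  have h_meas [measurable]: "h \<in> borel_measurable borel"
    unfolding h_def by (intro holomorphic_norm_borel_measurable holomorphic_on_subset[OF hol] sub) auto
  have h0: "0 \<le> h w" for w by (simp add: h_def)
  define e where "e x = of_real \<rho> * exp (2 * of_real pi * \<i> * of_real x)" for x :: real
  have e_meas [measurable]: "e \<in> borel_measurable borel"
    unfolding e_def by (intro borel_measurable_continuous_onI continuous_intros)
  have norm_e: "norm (e x) = \<rho>" for x using \<rho> by (simp add: e_def norm_mult)
  have bound: "ennreal (norm (f a)) \<le> 2 * (\<integral>\<^sup>+x\<in>{0..1}. ennreal (h (a + s + e x)) \<partial>lborel)"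
    if s: "norm s < \<rho> / 2" for s
  proof -
    have in_ball: "a + s + e x \<in> ball a (2 * \<rho>)" for x
    proof -
      have "dist a (a + s + e x) = norm (s + e x)"
        using norm_minus_cancel[of "s + e x"] by (simp add: dist_norm)
      then show ?thesis using norm_triangle_ineq[of s "e x"] norm_e[of x] s \<rho> by simp
    qed
    have cb: "cball (a + s) \<rho> \<subseteq> ball a (2 * \<rho>)"
    proof
      fix w assume "w \<in> cball (a + s) \<rho>"
      then have "dist (a + s) w \<le> \<rho>" "dist a (a + s) < \<rho> / 2" using s by (auto simp: dist_norm)
      then show "w \<in> ball a (2 * \<rho>)" using dist_triangle[of a w "a + s"] \<rho> by simp
    qed
    have ci: "((\<lambda>w. f w / (w - a)) has_contour_integral (2 * of_real pi * \<i> * f a)) (circlepath (a + s) \<rho>)"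
      using s cb sub \<rho>
      by (intro Cauchy_integral_circlepath_simple holomorphic_on_subset[OF hol]) auto
    define g where "g x = f (a + s + e x) / (a + s + e x - a) * (2 * pi * \<i> * e x)" for x
    have gi: "(g has_integral (2 * of_real pi * \<i> * f a)) {0..1}"
    proof (rule has_integral_cong[THEN iffD1, OF _ ci[unfolded has_contour_integral_def]])
      fix x :: real assume "x \<in> {0..1}"
      then show "f (circlepath (a + s) \<rho> x) / (circlepath (a + s) \<rho> x - a)
          * vector_derivative (circlepath (a + s) \<rho>) (at x within {0..1}) = g x"
        by (subst vector_derivative_circlepath01) (auto simp: circlepath g_def e_def mult_ac)
    qed
    \<comment> \<open>The restriction \<open>|s| < \<rho> / 2\<close> pays here: the pole
      \<open>a\<close> keeps distance \<open>\<rho> / 2\<close> from the circle, which costs only a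
      factor 2 against the centred mean value.\<close>
    have far: "norm (s + e x) \<ge> \<rho> / 2" for x
      using norm_triangle_ineq2[of "e x" "- s"] norm_e[of x] s by (simp add: add.commute)
    have cont: "continuous_on {0..1} g"
    proof -
      have "continuous_on {0..1} (\<lambda>x. f (a + s + e x))"
        by (rule continuous_on_compose2[OF holomorphic_on_imp_continuous_on[OF hol]])
           (use in_ball sub in \<open>auto simp: e_def intro!: continuous_intros\<close>)
      moreover have "s + e x \<noteq> 0" for x using far[of x] \<rho> by auto
      ultimately show ?thesis unfolding g_def e_def
        by (intro continuous_intros) (auto simp: e_def algebra_simps)
    qed
    have g_le: "norm (g x) \<le> 4 * pi * h (a + s + e x)" for x
    proof -
      have "norm (g x) = norm (f (a + s + e x)) * (2 * pi) * (\<rho> / norm (s + e x))"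
        using norm_e by (simp add: g_def norm_mult norm_divide)
      also have "\<dots> \<le> norm (f (a + s + e x)) * (2 * pi) * 2"
      proof (intro mult_left_mono)
        show "\<rho> / norm (s + e x) \<le> 2"
        using far[of x] \<rho> less_le_trans[of 0 "\<rho> / 2" "norm (s + e x)"]
          by (simp add: divide_le_eq)
      qed auto
      finally show ?thesis using in_ball[of x]
        by (simp add: h_def mult.commute mult.left_commute)
    qed
    have int: "integral {0..1} g = 2 * of_real pi * \<i> * f a"
      using gi by (rule integral_unique)
    have si: "set_integrable lborel {0..1} g"
      by (rule borel_integrable_atLeastAtMost') (rule cont)
    have "ennreal (norm (2 * of_real pi * \<i> * f a)) = ennreal (norm (LINT x:{0..1}|lborel. g x))"
      using set_borel_integral_eq_integral(2)[OF si] int by simp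
    also have "\<dots> \<le> (\<integral>\<^sup>+x. ennreal (norm (indicator {0..1} x *\<^sub>R g x)) \<partial>lborel)"
      unfolding set_lebesgue_integral_def
      using si by (intro integral_norm_bound_ennreal) (auto simp: set_integrable_def)
    also have "\<dots> \<le> (\<integral>\<^sup>+x. ennreal (4 * pi) * (ennreal (h (a + s + e x)) * indicator {0..1} x) \<partial>lborel)"
      proof (intro nn_integral_mono)
      fix x :: real
      show "ennreal (norm (indicator {0..1} x *\<^sub>R g x))
          \<le> ennreal (4 * pi) * (ennreal (h (a + s + e x)) * indicator {0..1} x)"
        using ennreal_leI[OF g_le[of x]] by (cases "x \<in> {0..1}") (simp_all add: ennreal_mult')
    qed
    also have "\<dots> = ennreal (4 * pi) * (\<integral>\<^sup>+x\<in>{0..1}. ennreal (h (a + s + e x)) \<partial>lborel)"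
      by (intro nn_integral_cmult) auto
    finally have "ennreal (2 * pi) * ennreal (norm (f a)) \<le>
        ennreal (2 * pi) * (2 * (\<integral>\<^sup>+x\<in>{0..1}. ennreal (h (a + s + e x)) \<partial>lborel))"
      proof -
      assume le: "ennreal (norm (2 * of_real pi * \<i> * f a))
        \<le> ennreal (4 * pi) * (\<integral>\<^sup>+x\<in>{0..1}. ennreal (h (a + s + e x)) \<partial>lborel)"
      have "ennreal (norm (2 * of_real pi * \<i> * f a)) = ennreal (2 * pi) * ennreal (norm (f a))"
        by (simp add: norm_mult ennreal_mult')
      moreover have "ennreal (4 * pi) = ennreal (2 * pi) * 2"
        using ennreal_mult'[of "2 * pi" 2] by simp
      ultimately show ?thesis using le by (simp only: mult.assoc)
    qed
    then show ?thesis
      by (subst (asm) ennreal_mult_le_mult_iff) (auto simp: top_unique)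
  qed
  \<comment> \<open>Integrating the constant left side over the disc of admissible \<open>s\<close>
    produces the area \<open>pi * \<rho>^2 / 4\<close>; on the right, after Fubini, each
    \<open>x\<close> contributes a translate of \<open>h\<close> integrated over the whole
    plane.\<close>
  have "ennreal (norm (f a)) * ennreal (pi * (\<rho> / 2)\<^sup>2)
      = (\<integral>\<^sup>+s. ennreal (norm (f a)) * indicator (ball 0 (\<rho> / 2)) s \<partial>(lborel :: complex measure))"
    using \<rho> by (simp add: nn_integral_cmult_indicator emeasure_complex_ball del: power_divide)
  also have "\<dots> \<le> (\<integral>\<^sup>+s. 2 * (\<integral>\<^sup>+x\<in>{0..1}. ennreal (h (a + s + e x)) \<partial>lborel) \<partial>lborel)"
    using bound by (intro nn_integral_mono) (auto split: split_indicator)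
  also have "\<dots> = 2 * (\<integral>\<^sup>+s. (\<integral>\<^sup>+x\<in>{0..1}. ennreal (h (a + s + e x)) \<partial>lborel) \<partial>lborel)"
    by (intro nn_integral_cmult) measurable
  also have "(\<integral>\<^sup>+s. (\<integral>\<^sup>+x\<in>{0..1}. ennreal (h (a + s + e x)) \<partial>lborel) \<partial>lborel)
      = (\<integral>\<^sup>+x. (\<integral>\<^sup>+s. ennreal (h (a + s + e x)) * indicator {0..1} x \<partial>lborel) \<partial>lborel)"
    by (rule lborel_pair.Fubini') measurable
  also have "\<dots> = (\<integral>\<^sup>+x. (\<integral>\<^sup>+w. ennreal (h w) \<partial>lborel) * indicator {0..1} (x::real) \<partial>lborel)"
  proof (intro nn_integral_cong)
    fix x :: real
    have "(\<integral>\<^sup>+s. ennreal (h (a + s + e x)) * indicator {0..1} x \<partial>lborel)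
        = (\<integral>\<^sup>+s. ennreal (h ((a + e x) + s)) \<partial>lborel) * indicator {0..1} x"
      by (subst nn_integral_multc) (auto simp: algebra_simps)
    then show "(\<integral>\<^sup>+s. ennreal (h (a + s + e x)) * indicator {0..1} x \<partial>lborel)
        = (\<integral>\<^sup>+w. ennreal (h w) \<partial>lborel) * indicator {0..1} x"
      by (subst (asm) nn_integral_translation) auto
  qed
  also have "\<dots> = (\<integral>\<^sup>+w. ennreal (h w) \<partial>lborel)"
    by (simp add: nn_integral_cmult_indicator)
  finally have *: "ennreal (norm (f a)) * ennreal (pi * (\<rho> / 2)\<^sup>2) \<le> 2 * (\<integral>\<^sup>+w. ennreal (h w) \<partial>lborel)" .
  have "ennreal (norm (f a)) * ennreal (\<rho>\<^sup>2)
      = ennreal (4 / pi) * (ennreal (norm (f a)) * ennreal (pi * (\<rho> / 2)\<^sup>2))"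
   proof -
    have "\<rho>\<^sup>2 = 4 / pi * (pi * (\<rho> / 2)\<^sup>2)" by (simp add: power2_eq_square)
    then have "ennreal (\<rho>\<^sup>2) = ennreal (4 / pi) * ennreal (pi * (\<rho> / 2)\<^sup>2)"
      by (metis ennreal_mult' divide_nonneg_nonneg pi_ge_zero zero_le_numeral)
    then show ?thesis by (simp only: mult_ac)
  qed
  also have "\<dots> \<le> ennreal (4 / pi) * (2 * (\<integral>\<^sup>+w. ennreal (h w) \<partial>lborel))"
    by (intro mult_left_mono *) auto
  also have "\<dots> = ennreal (8 / pi) * (\<integral>\<^sup>+w. ennreal (h w) \<partial>lborel)"
   using ennreal_mult'[of "4 / pi" 2] by (simp add: mult.assoc)
  also have "\<dots> \<le> ennreal 3 * (\<integral>\<^sup>+w. ennreal (h w) \<partial>lborel)"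
    using pi_gt3 by (intro mult_right_mono ennreal_leI) (auto simp: field_simps)
  finally show ?thesis
    by (simp add: h_def ennreal_mult'' ennreal_indicator)
qed

text \<open>Where \<open>exp t\<close> exceeds \<open>\<rho>\<close> the summand
  \<open>\<rho>\<close> is dropped from the denominator, elsewhere \<open>exp t\<close> is dropped;
  the two regimes give the exponents \<open>s\<close> and \<open>2 - s\<close>. Used for the Schur
  weights and, with \<open>s = 2 / p\<close>, for the ray integrals.\<close>

lemma exp_kernel_le:
  fixes s :: real
  assumes s: "0 < s" "s < 2" and \<rho>: "0 < \<rho>"
  shows "exp ((2 - s) * t) / (exp t + \<rho>)\<^sup>2 \<le> \<rho> powr (-s) * exp (- min s (2 - s) * \<bar>t - ln \<rho>\<bar>)"
proof (cases "ln \<rho> \<le> t")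
  case True
  have "exp ((2 - s) * t) / (exp t + \<rho>)\<^sup>2 \<le> exp ((2 - s) * t) / (exp t)\<^sup>2"
    using \<rho> by (intro divide_left_mono power_mono) (auto intro!: mult_pos_pos zero_less_power add_pos_pos)
  also have "\<dots> = exp (- s * t)"
    by (simp add: exp_diff[symmetric] exp_of_nat_mult[symmetric] algebra_simps)
  also have "\<dots> = \<rho> powr (-s) * exp (- s * (t - ln \<rho>))"
    using \<rho> by (simp add: powr_def exp_add[symmetric] algebra_simps)
  also have "\<dots> \<le> \<rho> powr (-s) * exp (- min s (2 - s) * \<bar>t - ln \<rho>\<bar>)"
    using True s by (intro mult_left_mono) (auto intro!: mult_right_mono)
  finally show ?thesis .
next
  case False
  have "exp ((2 - s) * t) / (exp t + \<rho>)\<^sup>2 \<le> exp ((2 - s) * t) / \<rho>\<^sup>2"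
    using \<rho> by (intro divide_left_mono power_mono) (auto intro!: mult_pos_pos zero_less_power add_pos_pos)
  also have "\<rho>\<^sup>2 = exp (2 * ln \<rho>)"
    using \<rho> by (simp add: exp_double)
  also have "exp ((2 - s) * t) / exp (2 * ln \<rho>) = \<rho> powr (-s) * exp (- (2 - s) * (ln \<rho> - t))"
    using \<rho> by (simp add: powr_def exp_add[symmetric] exp_diff[symmetric] algebra_simps)
  also have "\<dots> \<le> \<rho> powr (-s) * exp (- min s (2 - s) * \<bar>t - ln \<rho>\<bar>)"
    using False mult_right_mono[of "min s (2 - s)" "2 - s" "ln \<rho> - t"]
    by (intro mult_left_mono) (auto simp: algebra_simps)
  finally show ?thesis .
qed

text \<open>
  The radial weight is written as a superposition of indicators of the discs \<open>|w| < exp t\<close>, whose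
  areas are known; this replaces polar coordinates.
\<close>

lemma nn_integral_radial_kernel_le:
  fixes s :: real
  assumes s: "0 < s" "s < 2"
  obtains C where "0 < C"
    "\<And>\<rho>. 0 < \<rho> \<Longrightarrow> (\<integral>\<^sup>+w. ennreal (norm w powr (-s) / (norm w + \<rho>)\<^sup>2) \<partial>(lborel :: complex measure))
       \<le> ennreal (C * \<rho> powr (-s))"
proof -
  define a where "a = min s (2 - s)"
  have a: "0 < a" using s by (simp add: a_def)
  define C where "C = exp (s + 2) * pi * (2 / a)"
  have "(\<integral>\<^sup>+w. ennreal (norm w powr (-s) / (norm w + \<rho>)\<^sup>2) \<partial>(lborel :: complex measure))
       \<le> ennreal (C * \<rho> powr (-s))" if \<rho>: "0 < \<rho>" for \<rho>
  proof -
    define k where "k t = exp (- s * t) / (exp t + \<rho>)\<^sup>2" for t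
    have k0: "0 \<le> k t" for t by (simp add: k_def)
    have [measurable]: "k \<in> borel_measurable borel" unfolding k_def by measurable
    have [measurable]: "Measurable.pred borel (\<lambda>t. w \<in> ball 0 (exp t))" for w :: complex
      by simp
    have [measurable]: "Measurable.pred (borel \<Otimes>\<^sub>M borel) (\<lambda>x :: complex \<times> real. fst x \<in> ball 0 (exp (snd x)))"
      "Measurable.pred (borel \<Otimes>\<^sub>M borel) (\<lambda>x :: real \<times> complex. snd x \<in> ball 0 (exp (fst x)))"
      unfolding mem_ball_0 by measurable
    have pt: "ennreal (norm w powr (-s) / (norm w + \<rho>)\<^sup>2)
        \<le> ennreal (exp (s + 2)) * (\<integral>\<^sup>+t. ennreal (k t) * indicator (ball 0 (exp t)) w \<partial>lborel)" for w :: complex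
    proof (cases "w = 0")
      case True then show ?thesis by simp
    next
      case False
      define u where "u = ln (norm w)"
      have u: "exp u = norm w" using False by (simp add: u_def)
      define c where "c = norm w powr (-s) / (norm w + \<rho>)\<^sup>2"
      \<comment> \<open>The constant is spread over the unit interval above
        \<open>u = ln (norm w)\<close>. There \<open>exp t\<close> lies between \<open>|w|\<close>
        and \<open>e * |w|\<close>, so replacing \<open>|w|\<close> by \<open>exp t\<close> in the
        kernel costs at most \<open>exp (s + 2)\<close>. The left end is excluded because the disc
        is open.\<close>
      have "ennreal c = (\<integral>\<^sup>+t. ennreal c * indicator {u<..u+1} t \<partial>lborel)"
        by (simp add: nn_integral_cmult_indicator)
      also have "\<dots> \<le> (\<integral>\<^sup>+t. ennreal (exp (s + 2)) * (ennreal (k t) * indicator (ball 0 (exp t)) w) \<partial>lborel)"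
      proof (intro nn_integral_mono)
        fix t
        show "ennreal c * indicator {u<..u+1} t
            \<le> ennreal (exp (s + 2)) * (ennreal (k t) * indicator (ball 0 (exp t)) w)"
        proof (cases "t \<in> {u<..u+1}")
          case True
          then have "norm w < exp t" using u by (metis exp_less_mono greaterThanAtMost_iff)
          moreover have "c \<le> exp (s + 2) * k t"
          proof -
            have "exp t \<le> exp 1 * norm w"
              using True by (simp add: u[symmetric] exp_add[symmetric])
            moreover have "\<rho> \<le> exp 1 * \<rho>" using \<rho> by simp
            ultimately have "(exp t + \<rho>)\<^sup>2 \<le> (exp 1 * (norm w + \<rho>))\<^sup>2"
              unfolding distrib_left using \<rho> by (intro power_mono add_mono) auto
            then have "(exp t + \<rho>)\<^sup>2 \<le> exp 2 * (norm w + \<rho>)\<^sup>2"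
              by (simp add: power_mult_distrib exp_double[symmetric])
            moreover have "norm w powr (-s) \<le> exp s * exp (- s * t)"
            proof -
              have "norm w powr (-s) = exp (- s * u)" using False by (simp add: powr_def u_def)
              also have "\<dots> \<le> exp (s + - s * t)"
              proof -
                have "s * t \<le> s * (u + 1)" using True s by (intro mult_left_mono) auto
                then show ?thesis by (simp add: algebra_simps)
              qed
              finally show ?thesis by (simp add: exp_add exp_diff exp_minus divide_inverse)
            qed
            moreover have pos: "0 < exp t + \<rho>" "0 < norm w + \<rho>" using \<rho> by (auto intro: add_pos_pos add_nonneg_pos)
            ultimately have "norm w powr (-s) * (exp t + \<rho>)\<^sup>2
                \<le> (exp s * exp (- s * t)) * (exp 2 * (norm w + \<rho>)\<^sup>2)"
              by (intro mult_mono) auto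
            then show ?thesis
              using pos by (simp add: c_def k_def exp_add field_simps)
          qed
          ultimately show ?thesis using True by (simp add: ennreal_leI flip: ennreal_mult')
        qed auto
      qed
      also have "\<dots> = ennreal (exp (s + 2)) * (\<integral>\<^sup>+t. ennreal (k t) * indicator (ball 0 (exp t)) w \<partial>lborel)"
        by (intro nn_integral_cmult) measurable
      finally show ?thesis by (simp add: c_def)
    qed
    have "(\<integral>\<^sup>+w. ennreal (norm w powr (-s) / (norm w + \<rho>)\<^sup>2) \<partial>(lborel :: complex measure))
      \<le> (\<integral>\<^sup>+w. ennreal (exp (s + 2)) * (\<integral>\<^sup>+t. ennreal (k t) * indicator (ball 0 (exp t)) w \<partial>lborel) \<partial>(lborel :: complex measure))"
      by (intro nn_integral_mono pt)
    also have "\<dots> = ennreal (exp (s + 2)) * (\<integral>\<^sup>+w. (\<integral>\<^sup>+t. ennreal (k t) * indicator (ball 0 (exp t)) w \<partial>lborel) \<partial>(lborel :: complex measure))"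
      by (intro nn_integral_cmult) measurable
    also have "(\<integral>\<^sup>+w. (\<integral>\<^sup>+t. ennreal (k t) * indicator (ball 0 (exp t)) w \<partial>lborel) \<partial>(lborel :: complex measure))
        = (\<integral>\<^sup>+t. (\<integral>\<^sup>+w. ennreal (k t) * indicator (ball 0 (exp t)) (w :: complex) \<partial>lborel) \<partial>lborel)"
      by (rule lborel_pair.Fubini') measurable
    also have "\<dots> \<le> (\<integral>\<^sup>+t. ennreal (pi * \<rho> powr (-s)) * ennreal (exp (- a * \<bar>t - ln \<rho>\<bar>)) \<partial>lborel)"
    proof (intro nn_integral_mono)
      fix t
      \<comment> \<open>The area \<open>pi * exp (2 * t)\<close> of the disc raises the exponent
        \<open>- s\<close> of \<open>k\<close> to \<open>2 - s\<close>, the form that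
        \<open>exp_kernel_le\<close> bounds.\<close>
      have "(\<integral>\<^sup>+w. ennreal (k t) * indicator (ball 0 (exp t)) (w :: complex) \<partial>lborel)
          = ennreal (k t * (pi * (exp t)\<^sup>2))"
        by (simp add: nn_integral_cmult_indicator emeasure_complex_ball ennreal_mult k0)
      also have "k t * (pi * (exp t)\<^sup>2) = pi * (exp ((2 - s) * t) / (exp t + \<rho>)\<^sup>2)"
        by (simp add: k_def exp_double[symmetric] exp_add[symmetric] exp_diff exp_minus algebra_simps divide_inverse)
      also have "ennreal \<dots> \<le> ennreal (pi * (\<rho> powr (-s) * exp (- a * \<bar>t - ln \<rho>\<bar>)))"
        unfolding a_def using exp_kernel_le[OF s \<rho>] by (intro ennreal_leI mult_left_mono) auto
      finally show "(\<integral>\<^sup>+w. ennreal (k t) * indicator (ball 0 (exp t)) (w :: complex) \<partial>lborel)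
          \<le> ennreal (pi * \<rho> powr (-s)) * ennreal (exp (- a * \<bar>t - ln \<rho>\<bar>))"
        by (simp add: mult.assoc flip: ennreal_mult')
    qed
    also have "\<dots> = ennreal (pi * \<rho> powr (-s)) * (\<integral>\<^sup>+t. ennreal (exp (- a * \<bar>t - ln \<rho>\<bar>)) \<partial>lborel)"
      by (intro nn_integral_cmult) measurable
    also have "\<dots> \<le> ennreal (pi * \<rho> powr (-s)) * ennreal (2 / a)"
      by (intro mult_left_mono nn_integral_exp_abs_le a) auto
    also have "\<dots> = ennreal (pi * \<rho> powr (-s) * (2 / a))"
      using a by (intro ennreal_mult[symmetric]) auto
    finally have "(\<integral>\<^sup>+w. ennreal (norm w powr (-s) / (norm w + \<rho>)\<^sup>2) \<partial>(lborel :: complex measure))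
        \<le> ennreal (exp (s + 2)) * ennreal (pi * \<rho> powr (-s) * (2 / a))"
      by (simp add: mult_left_mono)
    also have "\<dots> = ennreal (C * \<rho> powr (-s))"
      using a by (simp add: C_def mult_ac flip: ennreal_mult')
    finally show ?thesis .
  qed
  moreover have "0 < C" using a by (simp add: C_def)
  ultimately show thesis using that by blast
qed

text \<open>The kernel maps \<open>|w|^(-s)\<close> to at most a multiple of \<open>|z|^(-s)\<close>
  when \<open>0 < s < 2\<close>, so powers are Schur test functions. Hoelder against the weight
  \<open>|w|^(-s)\<close> produces a factor \<open>|z|^(-\<sigma>)\<close> with
  \<open>\<sigma> = s * (p - 1)\<close>; after Fubini the same kernel estimate with
  \<open>\<sigma>\<close> integrates out \<open>z\<close>. \<open>C\<close> is fixed before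
  \<open>h\<close>, \<open>X\<close> and \<open>S\<close>, hence depends on \<open>p\<close>
  alone.\<close>

lemma Schur_test_radial:
  assumes p: "1 < p"
  obtains C where "0 < C"
    "\<And>(h :: complex \<Rightarrow> real) X (S :: complex set). \<lbrakk>h \<in> borel_measurable borel; \<And>w. 0 \<le> h w; h 0 = 0; 0 \<notin> S;
        \<And>z. z \<in> S \<Longrightarrow> 0 \<le> X z;
        \<And>z. z \<in> S \<Longrightarrow> ennreal (X z) \<le> (\<integral>\<^sup>+w. ennreal (h w / (norm w + norm z)\<^sup>2) \<partial>lborel)\<rbrakk>
      \<Longrightarrow> (\<integral>\<^sup>+z. ennreal (X z powr p) * indicator S z \<partial>lborel)
          \<le> ennreal C * (\<integral>\<^sup>+w. ennreal (h w powr p) \<partial>lborel)"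
proof -
  \<comment> \<open>Both \<open>s\<close> and \<open>s * (p - 1)\<close> must lie strictly between 0
    and 2; \<open>1 / p\<close> puts both below 1.\<close>
  define s where "s = 1 / p"
  define \<sigma> where "\<sigma> = s * (p - 1)"
  have s: "0 < s" "s < 2" using p by (auto simp: s_def field_simps)
  have \<sigma>: "0 < \<sigma>" "\<sigma> < 2" using p by (auto simp: \<sigma>_def s_def field_simps)
  obtain C1 where C1: "0 < C1"
    "\<And>\<rho>. 0 < \<rho> \<Longrightarrow> (\<integral>\<^sup>+w. ennreal (norm w powr (-s) / (norm w + \<rho>)\<^sup>2) \<partial>(lborel :: complex measure))
       \<le> ennreal (C1 * \<rho> powr (-s))"
    using nn_integral_radial_kernel_le[OF s] by metis
  obtain C2 where C2: "0 < C2"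
    "\<And>\<rho>. 0 < \<rho> \<Longrightarrow> (\<integral>\<^sup>+w. ennreal (norm w powr (-\<sigma>) / (norm w + \<rho>)\<^sup>2) \<partial>(lborel :: complex measure))
       \<le> ennreal (C2 * \<rho> powr (-\<sigma>))"
    using nn_integral_radial_kernel_le[OF \<sigma>] by metis
  show thesis
  proof (rule that)
    show "0 < C1 powr (p - 1) * C2" using C1 C2 by simp
    fix h :: "complex \<Rightarrow> real" and X and S :: "complex set"
    assume [measurable]: "h \<in> borel_measurable borel"
      and h: "\<And>w. 0 \<le> h w" "h 0 = 0" and S: "0 \<notin> S" and X0: "\<And>z. z \<in> S \<Longrightarrow> 0 \<le> X z"
      and X: "\<And>z. z \<in> S \<Longrightarrow> ennreal (X z) \<le> (\<integral>\<^sup>+w. ennreal (h w / (norm w + norm z)\<^sup>2) \<partial>lborel)"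
    define K where "K w z = h w powr p * norm w powr \<sigma> * (norm z powr (-\<sigma>) / (norm z + norm w)\<^sup>2)"
      for w z :: complex
    have pt: "ennreal (X z powr p) \<le> ennreal (C1 powr (p - 1)) * (\<integral>\<^sup>+w. ennreal (K w z) \<partial>lborel)"
      if z: "z \<in> S" for z
    proof -
      have z0: "0 < norm z" using z S by auto
      have "ennreal (X z powr p) \<le> ennreal ((C1 * norm z powr (-s)) powr (p - 1)) *
          (\<integral>\<^sup>+w. ennreal ((h w * norm w powr s) powr p * (norm w powr (-s) / (norm w + norm z)\<^sup>2)) \<partial>lborel)"
      proof (rule Holder_weighted[OF _ _ _ _ p C1(2)[OF z0] _ X0[OF z]])
        \<comment> \<open>At \<open>w = 0\<close> the inserted powers do not cancel, since
          \<open>0 powr s = 0\<close>; there the equation holds because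
          \<open>h 0 = 0\<close>.\<close>
        have eq: "h w * norm w powr s * (norm w powr - s / (norm w + norm z)\<^sup>2) = h w / (norm w + norm z)\<^sup>2" for w :: complex
          using h by (cases "w = 0") (auto simp: powr_minus)
        show "ennreal (X z)
          \<le> (\<integral>\<^sup>+w. ennreal (h w * norm w powr s * (norm w powr - s / (norm w + norm z)\<^sup>2)) \<partial>lborel)"
          unfolding eq by (rule X[OF z])
      qed (use h C1 z0 in auto)
      also have "(C1 * norm z powr (-s)) powr (p - 1) = C1 powr (p - 1) * norm z powr (-\<sigma>)"
        using C1 by (simp add: powr_mult powr_powr \<sigma>_def)
      also have "(\<lambda>w. (h w * norm w powr s) powr p * (norm w powr (-s) / (norm w + norm z)\<^sup>2))
          = (\<lambda>w. h w powr p * norm w powr \<sigma> / (norm w + norm z)\<^sup>2)"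
      proof
        fix w :: complex
        have "norm w powr (s * p) * norm w powr (-s) = norm w powr \<sigma>"
          by (simp add: \<sigma>_def algebra_simps flip: powr_add)
        then show "(h w * norm w powr s) powr p * (norm w powr (-s) / (norm w + norm z)\<^sup>2)
            = h w powr p * norm w powr \<sigma> / (norm w + norm z)\<^sup>2"
          using h by (simp add: powr_mult powr_powr)
      qed
      also have "ennreal (C1 powr (p - 1) * norm z powr (-\<sigma>)) *
          (\<integral>\<^sup>+w. ennreal (h w powr p * norm w powr \<sigma> / (norm w + norm z)\<^sup>2) \<partial>lborel)
          = ennreal (C1 powr (p - 1)) * (\<integral>\<^sup>+w. ennreal (norm z powr (-\<sigma>)) *
              ennreal (h w powr p * norm w powr \<sigma> / (norm w + norm z)\<^sup>2) \<partial>lborel)"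
        by (subst nn_integral_cmult) (auto simp: ennreal_mult mult.assoc)
      also have "\<dots> = ennreal (C1 powr (p - 1)) * (\<integral>\<^sup>+w. ennreal (K w z) \<partial>lborel)"
        by (intro arg_cong2[where f = "(*)"] nn_integral_cong refl)
           (simp add: K_def add.commute mult_ac flip: ennreal_mult')
      finally show ?thesis .
    qed
    have "(\<integral>\<^sup>+z. ennreal (X z powr p) * indicator S z \<partial>lborel)
        \<le> (\<integral>\<^sup>+z. ennreal (C1 powr (p - 1)) * (\<integral>\<^sup>+w. ennreal (K w z) \<partial>lborel) \<partial>lborel)"
      using pt by (intro nn_integral_mono) (auto split: split_indicator)
    also have "\<dots> = ennreal (C1 powr (p - 1)) * (\<integral>\<^sup>+z. (\<integral>\<^sup>+w. ennreal (K w z) \<partial>lborel) \<partial>lborel)"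
      unfolding K_def by (intro nn_integral_cmult) measurable
    also have "(\<integral>\<^sup>+z. (\<integral>\<^sup>+w. ennreal (K w z) \<partial>lborel) \<partial>lborel)
        = (\<integral>\<^sup>+w. (\<integral>\<^sup>+z. ennreal (K w z) \<partial>lborel) \<partial>lborel)"
      unfolding K_def by (rule lborel_pair.Fubini') measurable
    also have "\<dots> \<le> (\<integral>\<^sup>+w. ennreal C2 * ennreal (h w powr p) \<partial>lborel)"
    proof (intro nn_integral_mono)
      fix w
      show "(\<integral>\<^sup>+z. ennreal (K w z) \<partial>lborel) \<le> ennreal C2 * ennreal (h w powr p)"
      proof (cases "w = 0")
        case True then show ?thesis using h by (simp add: K_def)
      next
        case False
        have "(\<integral>\<^sup>+z. ennreal (K w z) \<partial>lborel) = ennreal (h w powr p * norm w powr \<sigma>) *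
          (\<integral>\<^sup>+z. ennreal (norm z powr (-\<sigma>) / (norm z + norm w)\<^sup>2) \<partial>(lborel :: complex measure))"
          unfolding K_def
          by (subst nn_integral_cmult[symmetric], measurable) (intro nn_integral_cong ennreal_mult; simp add: h)
        also have "\<dots> \<le> ennreal (h w powr p * norm w powr \<sigma>) * ennreal (C2 * norm w powr (-\<sigma>))"
          using False by (intro mult_left_mono C2) auto
        also have "\<dots> = ennreal C2 * ennreal (h w powr p)"
          using False C2 by (simp add: powr_minus mult_ac flip: ennreal_mult')
        finally show ?thesis .
      qed
    qed
    also have "\<dots> = ennreal C2 * (\<integral>\<^sup>+w. ennreal (h w powr p) \<partial>lborel)"
      by (intro nn_integral_cmult) measurable
    finally show "(\<integral>\<^sup>+z. ennreal (X z powr p) * indicator S z \<partial>lborel)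
          \<le> ennreal (C1 powr (p - 1) * C2) * (\<integral>\<^sup>+w. ennreal (h w powr p) \<partial>lborel)"
      using C2 by (simp add: ennreal_mult' mult_left_mono mult.assoc)
  qed
qed

subsection \<open>Wedges and the ray kernel\<close>

text \<open>Angles in the universal cover of the punctured plane: \<open>\<alpha>\<close> and \<open>\<beta>\<close> are not reduced modulo \<open>2\<pi>\<close>.\<close>

definition wedge :: "real \<Rightarrow> real \<Rightarrow> complex set" where
  "wedge \<alpha> \<beta> = exp ` {\<omega>. \<alpha> < Im \<omega> \<and> Im \<omega> < \<beta>}"

lemma wedgeI: "\<alpha> < Im \<omega> \<Longrightarrow> Im \<omega> < \<beta> \<Longrightarrow> exp \<omega> \<in> wedge \<alpha> \<beta>"
  by (auto simp: wedge_def)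

lemma wedgeE:
  assumes "z \<in> wedge \<alpha> \<beta>"
  obtains \<omega> where "z = exp \<omega>" "\<alpha> < Im \<omega>" "Im \<omega> < \<beta>"
  using assms by (auto simp: wedge_def)

lemma wedge_mono: "\<alpha>' \<le> \<alpha> \<Longrightarrow> \<beta> \<le> \<beta>' \<Longrightarrow> wedge \<alpha> \<beta> \<subseteq> wedge \<alpha>' \<beta>'"
  by (fastforce simp: wedge_def)

lemma zero_notin_wedge: "0 \<notin> wedge \<alpha> \<beta>"
  by (auto simp: wedge_def)

lemma open_strip: "open {\<omega>. \<alpha> < Im \<omega> \<and> Im \<omega> < \<beta>}"
  by (intro open_Collect_conj open_Collect_less continuous_intros)

lemma convex_strip: "convex {\<omega>. \<alpha> < Im \<omega> \<and> Im \<omega> < \<beta>}"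
proof -
  have "{\<omega>. \<alpha> < Im \<omega> \<and> Im \<omega> < \<beta>} = {\<omega>. \<alpha> < Im \<omega>} \<inter> {\<omega>. Im \<omega> < \<beta>}" by auto
  then show ?thesis
    by (simp add: convex_Int convex_halfspace_Im_gt convex_halfspace_Im_lt)
qed

lemma open_wedge: "open (wedge \<alpha> \<beta>)"
  unfolding wedge_def
proof (rule open_mapping_thm[where S = UNIV])
  show "\<not> exp constant_on (UNIV :: complex set)"
    unfolding constant_on_def
  proof
    assume "\<exists>y. \<forall>x\<in>UNIV. exp x = (y :: complex)"
    then obtain y where "\<And>x. exp x = (y :: complex)" by auto
    then have "exp (complex_of_real 1) = exp (complex_of_real 0)" by simp
    then show False by (simp only: exp_of_real of_real_eq_iff exp_inj_iff)
  qed
qed (auto intro!: holomorphic_intros open_strip)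

lemma exp_mult_mem_wedge: "z \<in> wedge \<alpha> \<beta> \<Longrightarrow> exp (of_real t) * z \<in> wedge \<alpha> \<beta>"
  by (auto elim!: wedgeE intro!: wedgeI simp flip: exp_add)

lemma Im_exp_mult_cis: "Im (exp \<omega> * cis (- \<alpha>)) = exp (Re \<omega>) * sin (Im \<omega> - \<alpha>)"
  by (simp add: exp_eq_polar mult.assoc cis_mult)

lemma wedge_half_turn: "wedge \<alpha> (\<alpha> + pi) = {z. 0 < Im (z * cis (- \<alpha>))}"
proof (intro equalityI subsetI)
  fix z assume "z \<in> wedge \<alpha> (\<alpha> + pi)"
  then obtain \<omega> where "z = exp \<omega>" "\<alpha> < Im \<omega>" "Im \<omega> < \<alpha> + pi" by (rule wedgeE)
  then show "z \<in> {z. 0 < Im (z * cis (- \<alpha>))}"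
    unfolding mem_Collect_eq by (simp only: Im_exp_mult_cis) (auto intro!: mult_pos_pos sin_gt_zero)
next
  fix z assume z: "z \<in> {z. 0 < Im (z * cis (- \<alpha>))}"
  define w where "w = z * cis (- \<alpha>)"
  have w: "0 < Im w" "w \<noteq> 0" using z by (auto simp: w_def)
  have "z = w * cis \<alpha>" by (simp add: w_def mult.assoc cis_mult)
  also have "\<dots> = exp (Ln w + \<i> * \<alpha>)" using w by (simp add: exp_add cis_conv_exp)
  finally show "z \<in> wedge \<alpha> (\<alpha> + pi)"
    using Im_Ln_pos_lt_imp[of w] w Arg_lt_pi[of w] Im_Ln_pos_lt[OF w(2)]
    by (auto intro!: wedgeI)
qed

text \<open>The difference of squares vanishes when \<open>exp \<omega>\<close> meets
  \<open>z\<close> or \<open>- z\<close>, and the sine of the angle between them controls both poles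
  at once. With \<open>r\<close>, \<open>q\<close> the moduli and \<open>\<delta>\<close> the angle,
  the law of cosines at angle \<open>2 * \<delta>\<close> splits the squared norm into
  \<open>((r^2 + q^2) * sin \<delta>)^2\<close> and a nonnegative rest.\<close>

lemma norm_exp_diff_ge:
  fixes \<omega> \<zeta> :: complex
  shows "(exp (Re \<omega>) + norm (exp \<zeta>))\<^sup>2 * \<bar>sin (Im \<zeta> - Im \<omega>)\<bar> / 2 \<le> norm (exp (2 * \<omega>) - (exp \<zeta>)\<^sup>2)"
proof -
  define r where "r = exp (Re \<omega>)"
  define q where "q = exp (Re \<zeta>)"
  define \<delta> where "\<delta> = Im \<zeta> - Im \<omega>"
  have pos: "0 < r" "0 < q" by (auto simp: r_def q_def)
  have 1: "exp (2 * \<omega>) = of_real (r\<^sup>2) * cis (2 * Im \<omega>)"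
    by (simp add: exp_eq_polar r_def exp_double)
  have 2: "(exp \<zeta>)\<^sup>2 = of_real (q\<^sup>2) * cis (2 * Im \<zeta>)"
    unfolding exp_double[symmetric] by (subst exp_eq_polar) (simp add: q_def exp_double)
  have polar: "(norm (of_real R * cis A - of_real Q * cis B))\<^sup>2 = R\<^sup>2 + Q\<^sup>2 - 2 * R * Q * cos (B - A)" for R Q A B
  proof -
    have "(norm (of_real R * cis A - of_real Q * cis B))\<^sup>2
        = (R * cos A - Q * cos B)\<^sup>2 + (R * sin A - Q * sin B)\<^sup>2"
      unfolding cmod_power2 by simp
    also have "\<dots> = R\<^sup>2 * ((sin A)\<^sup>2 + (cos A)\<^sup>2) + Q\<^sup>2 * ((sin B)\<^sup>2 + (cos B)\<^sup>2)
        - 2 * R * Q * (cos B * cos A + sin B * sin A)"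
      by (simp only: power2_eq_square algebra_simps)
    finally show ?thesis by (simp add: cos_diff)
  qed
  have dbl: "cos (2 * Im \<zeta> - 2 * Im \<omega>) = 1 - 2 * (sin \<delta>)\<^sup>2"
    unfolding cos_double_sin[symmetric] by (simp add: \<delta>_def algebra_simps)
  have "(norm (exp (2 * \<omega>) - (exp \<zeta>)\<^sup>2))\<^sup>2 = (r\<^sup>2)\<^sup>2 + (q\<^sup>2)\<^sup>2 - 2 * r\<^sup>2 * q\<^sup>2 * (1 - 2 * (sin \<delta>)\<^sup>2)"
    unfolding 1 2 polar dbl ..
  also have "\<dots> = ((r\<^sup>2 + q\<^sup>2) * \<bar>sin \<delta>\<bar>)\<^sup>2 + (r\<^sup>2 - q\<^sup>2)\<^sup>2 * (1 - (sin \<delta>)\<^sup>2)"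
    unfolding power_mult_distrib power2_abs by (simp add: power2_eq_square algebra_simps)
  also have "\<dots> \<ge> ((r\<^sup>2 + q\<^sup>2) * \<bar>sin \<delta>\<bar>)\<^sup>2"
    by (simp add: abs_square_le_1)
  finally have "(r\<^sup>2 + q\<^sup>2) * \<bar>sin \<delta>\<bar> \<le> norm (exp (2 * \<omega>) - (exp \<zeta>)\<^sup>2)"
    by (rule power2_le_imp_le) auto
  moreover have "(r + q)\<^sup>2 / 2 \<le> r\<^sup>2 + q\<^sup>2"
    using zero_le_power2[of "r - q"] by (simp add: power2_eq_square algebra_simps)
  then have "(r + q)\<^sup>2 / 2 * \<bar>sin \<delta>\<bar> \<le> (r\<^sup>2 + q\<^sup>2) * \<bar>sin \<delta>\<bar>"
    by (rule mult_right_mono) auto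
  ultimately show ?thesis by (simp add: r_def q_def \<delta>_def)
qed

text \<open>Compactness gives a uniform margin on the unit arc, and dilation invariance of the wedge
  scales it to every modulus. The cap \<open>1 / 2\<close> keeps the points of such a ball
  comparable in modulus to its centre.\<close>

lemma cone_margin:
  assumes "\<alpha> < \<alpha>1" "\<alpha>2 < \<beta>"
  obtains \<kappa> where "0 < \<kappa>" "\<kappa> \<le> 1 / 2"
    "\<And>\<omega>. Im \<omega> \<in> {\<alpha>1..\<alpha>2} \<Longrightarrow> ball (exp \<omega>) (\<kappa> * exp (Re \<omega>)) \<subseteq> wedge \<alpha> \<beta>"
proof -
  have "compact (cis ` {\<alpha>1..\<alpha>2})"
    by (intro compact_continuous_image continuous_intros) auto
  moreover have "cis ` {\<alpha>1..\<alpha>2} \<subseteq> wedge \<alpha> \<beta>"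
    using assms by (auto simp: cis_conv_exp intro!: wedgeI)
  ultimately obtain \<epsilon> where \<epsilon>: "\<epsilon> > 0" "(\<Union>x\<in>cis ` {\<alpha>1..\<alpha>2}. ball x \<epsilon>) \<subseteq> wedge \<alpha> \<beta>"
    using compact_subset_open_imp_ball_epsilon_subset open_wedge by metis
  define \<kappa> where "\<kappa> = min \<epsilon> (1 / 2)"
  have "ball (exp \<omega>) (\<kappa> * exp (Re \<omega>)) \<subseteq> wedge \<alpha> \<beta>" if \<omega>: "Im \<omega> \<in> {\<alpha>1..\<alpha>2}" for \<omega>
  proof
    fix w assume w: "w \<in> ball (exp \<omega>) (\<kappa> * exp (Re \<omega>))"
    define v where "v = exp (of_real (- Re \<omega>)) * w"
    have e: "exp (of_real (- Re \<omega>)) * exp \<omega> = cis (Im \<omega>)"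
      by (simp add: exp_eq_polar exp_minus)
    have "norm (exp (of_real (- Re \<omega>)) * (exp \<omega> - w)) = exp (- Re \<omega>) * dist (exp \<omega>) w"
      by (simp only: norm_mult norm_exp_eq_Re Re_complex_of_real dist_norm)
    also have "\<dots> < exp (- Re \<omega>) * (\<kappa> * exp (Re \<omega>))"
      using w by simp
    also have "\<dots> = \<kappa>" by (simp add: exp_minus)
    finally have "v \<in> ball (cis (Im \<omega>)) \<epsilon>"
      unfolding right_diff_distrib e by (simp add: v_def dist_norm \<kappa>_def)
    then have "v \<in> wedge \<alpha> \<beta>" using \<epsilon> \<omega> by blast
    from exp_mult_mem_wedge[OF this, of "Re \<omega>"] show "w \<in> wedge \<alpha> \<beta>"
      by (simp add: v_def mult.assoc[symmetric] flip: exp_add)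
  qed
  then show thesis using that[of \<kappa>] \<epsilon> by (auto simp: \<kappa>_def)
qed

text \<open>With \<open>w = exp \<omega>\<close> this is
  \<open>w * (1 / (w - z) + 1 / (w + z))\<close>; the extra factor \<open>w\<close> is
  \<open>dw / d\<omega>\<close>.\<close>

definition ray_kernel :: "complex \<Rightarrow> complex \<Rightarrow> complex" where
  "ray_kernel z \<omega> = 2 * exp (2 * \<omega>) / (exp (2 * \<omega>) - z\<^sup>2)"

text \<open>The contour integral along the ray of angle \<open>\<gamma>\<close>, in the variable
  \<open>t = ln |w|\<close>. The factor \<open>1 / (2 * pi * \<i>)\<close> is left out here and
  enters only in the decomposition.\<close>

definition ray_transform :: "(complex \<Rightarrow> complex) \<Rightarrow> real \<Rightarrow> complex \<Rightarrow> complex" where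
  "ray_transform f \<gamma> z = (LINT t|lborel. f (exp (Complex t \<gamma>)) * ray_kernel z (Complex t \<gamma>))"

section \<open>Bergman functions on a wedge: extension by zero and growth along rays\<close>

locale wedge_function =
  fixes f :: "complex \<Rightarrow> complex" and p \<alpha> \<beta> :: real
  assumes p: "1 < p" and angle: "\<alpha> < \<beta>" "\<beta> - \<alpha> < pi"
    and hol: "f holomorphic_on wedge \<alpha> \<beta>"
    and fin: "(\<integral>\<^sup>+w. ennreal (norm (f w) powr p) * indicator (wedge \<alpha> \<beta>) w \<partial>lborel) < \<infinity>"
begin

text \<open>\<open>f\<close> is arbitrary off the wedge; extending its modulus by 0 gives a Borel
  function on the whole plane that vanishes at the apex, as Schur's test asks.\<close>

definition f0 where "f0 w = norm (f w) * indicator (wedge \<alpha> \<beta>) w"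

lemma f0_measurable [measurable]: "f0 \<in> borel_measurable borel"
  unfolding f0_def[abs_def] by (intro holomorphic_norm_borel_measurable hol open_wedge)

lemma f0_nonneg [simp]: "0 \<le> f0 w"
  by (simp add: f0_def)

lemma f0_fin: "(\<integral>\<^sup>+w. ennreal (f0 w powr p) \<partial>lborel) < \<infinity>"
proof -
  have "(\<integral>\<^sup>+w. ennreal (f0 w powr p) \<partial>lborel)
      = (\<integral>\<^sup>+w. ennreal (norm (f w) powr p) * indicator (wedge \<alpha> \<beta>) w \<partial>lborel)"
    by (intro nn_integral_cong) (auto simp: f0_def split: split_indicator)
  then show ?thesis using fin by simp
qed

lemma mean_value_bound:
  assumes "ball (exp \<omega>) (\<kappa> * exp (Re \<omega>)) \<subseteq> wedge \<alpha> \<beta>" "0 < \<kappa>"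
  shows "ennreal (norm (f (exp \<omega>)) * (\<kappa> * exp (Re \<omega>) / 2)\<^sup>2 / 3)
    \<le> (\<integral>\<^sup>+w. ennreal (f0 w * indicator (ball (exp \<omega>) (\<kappa> * exp (Re \<omega>))) w) \<partial>lborel)"
proof -
  define B where "B = ball (exp \<omega>) (\<kappa> * exp (Re \<omega>))"
  have "ennreal (norm (f (exp \<omega>))) * ennreal ((\<kappa> * exp (Re \<omega>) / 2)\<^sup>2)
      \<le> ennreal 3 * (\<integral>\<^sup>+w. ennreal (norm (f w)) * indicator B w \<partial>lborel)"
    using holomorphic_norm_le_nn_integral_ball[OF hol open_wedge, of "exp \<omega>" "\<kappa> * exp (Re \<omega>) / 2"] assms
    by (simp add: B_def)
  also have "(\<lambda>w. ennreal (norm (f w)) * indicator B w) = (\<lambda>w. ennreal (f0 w * indicator B w))"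
    using assms by (auto simp: f0_def B_def fun_eq_iff split: split_indicator)
  finally have "ennreal (1 / 3) * (ennreal (norm (f (exp \<omega>))) * ennreal ((\<kappa> * exp (Re \<omega>) / 2)\<^sup>2))
      \<le> ennreal (1 / 3) * (ennreal 3 * (\<integral>\<^sup>+w. ennreal (f0 w * indicator B w) \<partial>lborel))"
    by (rule mult_left_mono) auto
  moreover have "ennreal (1 / 3) * (ennreal 3 * I) = I" for I
    unfolding mult.assoc[symmetric] by (subst ennreal_mult[symmetric]) auto
  moreover have "ennreal (1 / 3) * (ennreal (norm (f (exp \<omega>))) * ennreal ((\<kappa> * exp (Re \<omega>) / 2)\<^sup>2))
      = ennreal (norm (f (exp \<omega>)) * (\<kappa> * exp (Re \<omega>) / 2)\<^sup>2 / 3)"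
    by (simp add: mult_ac flip: ennreal_mult)
  ultimately show ?thesis by (simp only: B_def)
qed

text \<open>The mean value inequality on a ball of radius proportional to \<open>|w|\<close>,
  combined with Hoelder on that ball, bounds \<open>|f(w)|^p * |w|^2\<close> by a multiple of the
  integral of \<open>|f|^p\<close>. Hence the exponent \<open>- 2 / p\<close>, uniformly on a closed
  subsector.\<close>

lemma growth:
  assumes "\<alpha> < \<alpha>1" "\<alpha>2 < \<beta>"
  obtains C where "0 \<le> C" "\<And>\<omega>. Im \<omega> \<in> {\<alpha>1..\<alpha>2} \<Longrightarrow> norm (f (exp \<omega>)) \<le> C * exp (- (2 / p) * Re \<omega>)"
proof -
  obtain \<kappa> where \<kappa>: "0 < \<kappa>"
    "\<And>\<omega>. Im \<omega> \<in> {\<alpha>1..\<alpha>2} \<Longrightarrow> ball (exp \<omega>) (\<kappa> * exp (Re \<omega>)) \<subseteq> wedge \<alpha> \<beta>"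
    using cone_margin[OF assms] by metis
  obtain N where N: "0 \<le> N" "(\<integral>\<^sup>+w. ennreal (f0 w powr p) \<partial>lborel) = ennreal N"
    using f0_fin by (metis ennreal_cases infinity_ennreal_def less_irrefl)
  \<comment> \<open>The 12 is the 3 of the area mean value inequality times the 4 from halving the
    radius there.\<close>
  define C where "C = 12 / \<kappa>\<^sup>2 * ((pi * \<kappa>\<^sup>2) powr (p - 1) * N) powr (1 / p)"
  have "norm (f (exp \<omega>)) \<le> C * exp (- (2 / p) * Re \<omega>)" if \<omega>: "Im \<omega> \<in> {\<alpha>1..\<alpha>2}" for \<omega>
  proof -
    define r where "r = \<kappa> * exp (Re \<omega>)"
    have r: "0 < r" using \<kappa> by (simp add: r_def)
    define x where "x = norm (f (exp \<omega>)) * (r / 2)\<^sup>2 / 3"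
    have "ennreal (x powr p) \<le> ennreal ((pi * r\<^sup>2) powr (p - 1)) *
        (\<integral>\<^sup>+w. ennreal (f0 w powr p * indicator (ball (exp \<omega>) r) w) \<partial>lborel)"
    proof (rule Holder_weighted[OF _ _ _ _ p])
      show "(\<integral>\<^sup>+w. ennreal (indicator (ball (exp \<omega>) r) w) \<partial>lborel) \<le> ennreal (pi * r\<^sup>2)"
        using r by (simp add: ennreal_indicator emeasure_complex_ball)
      show "ennreal x \<le> (\<integral>\<^sup>+w. ennreal (f0 w * indicator (ball (exp \<omega>) r) w) \<partial>lborel)"
        using mean_value_bound[OF \<kappa>(2)[OF \<omega>] \<kappa>(1)] by (simp add: x_def r_def)
    qed (use r in \<open>auto simp: x_def intro!: borel_measurable_indicator\<close>)
    also have "\<dots> \<le> ennreal ((pi * r\<^sup>2) powr (p - 1)) * ennreal N"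
      unfolding N(2)[symmetric]
      by (intro mult_left_mono nn_integral_mono ennreal_leI) (auto split: split_indicator)
    also have "\<dots> = ennreal ((pi * r\<^sup>2) powr (p - 1) * N)"
      using N by (simp add: ennreal_mult)
    finally have "x powr p \<le> (pi * r\<^sup>2) powr (p - 1) * N"
      using N by (subst (asm) ennreal_le_iff) auto
    then have "(x powr p) powr (1 / p) \<le> ((pi * r\<^sup>2) powr (p - 1) * N) powr (1 / p)"
      using p by (intro powr_mono2) auto
    moreover have "0 \<le> x" by (simp add: x_def)
    ultimately have "x \<le> ((pi * r\<^sup>2) powr (p - 1) * N) powr (1 / p)"
      using p by (simp add: powr_powr)
    also have "(pi * r\<^sup>2) powr (p - 1) = (pi * \<kappa>\<^sup>2) powr (p - 1) * exp (2 * (p - 1) * Re \<omega>)"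
      using \<kappa> by (simp add: r_def power_mult_distrib powr_mult exp_double[symmetric] powr_def ln_mult exp_add[symmetric] algebra_simps)
    also have "((pi * \<kappa>\<^sup>2) powr (p - 1) * exp (2 * (p - 1) * Re \<omega>) * N) powr (1 / p)
        = ((pi * \<kappa>\<^sup>2) powr (p - 1) * N) powr (1 / p) * exp (2 * (p - 1) * Re \<omega>) powr (1 / p)"
      using N by (simp add: powr_mult[symmetric] mult_ac)
    also have "exp (2 * (p - 1) * Re \<omega>) powr (1 / p) = exp (2 * Re \<omega>) * exp (- (2 / p) * Re \<omega>)"
      using p by (simp add: powr_def exp_add[symmetric] field_simps)
    finally have "norm (f (exp \<omega>)) * (\<kappa>\<^sup>2 * exp (2 * Re \<omega>) / 12)
        \<le> ((pi * \<kappa>\<^sup>2) powr (p - 1) * N) powr (1 / p) * (exp (2 * Re \<omega>) * exp (- (2 / p) * Re \<omega>))"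
      by (simp add: x_def r_def power_divide power_mult_distrib exp_double mult.assoc)
    then show ?thesis using \<kappa>(1) by (simp add: C_def field_simps)
  qed
  moreover have "0 \<le> C" using N by (simp add: C_def)
  ultimately show thesis using that by blast
qed

end

text \<open>Differentiation under the integral by the exact expansion of
  \<open>1 / (W - s - e)\<close> to second order in \<open>e\<close>. The uniform gap
  \<open>d\<close> between \<open>s\<close> and the values of \<open>W\<close> dominates derivative
  and remainder by multiples of \<open>|h / (W - s)|\<close>, which is integrable.\<close>

lemma Cauchy_transform_differentiable:
  fixes h W :: "'a \<Rightarrow> complex"
  assumes [measurable]: "h \<in> borel_measurable M" "W \<in> borel_measurable M"
    and d: "0 < d" "\<And>t. d \<le> norm (W t - s)"
    and int: "integrable M (\<lambda>t. h t / (W t - s))"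
  shows "(\<lambda>s. LINT t|M. h t / (W t - s)) field_differentiable at s"
proof -
  define k where "k t = h t / (W t - s)" for t
  have nz: "W t - s \<noteq> 0" for t using d(2)[of t] d(1) by auto
  have [measurable]: "k \<in> borel_measurable M" unfolding k_def by measurable
  have k: "integrable M k" using int by (simp add: k_def[abs_def])
  have k2: "integrable M (\<lambda>t. k t / (W t - s))"
  proof (rule Bochner_Integration.integrable_bound[OF integrable_mult_right[OF integrable_norm[OF k], of "1 / d"]])
    show "AE t in M. norm (k t / (W t - s)) \<le> norm (1 / d * norm (k t))"
    proof (intro AE_I2)
      fix t
      have "norm (k t) / norm (W t - s) \<le> norm (k t) / d"
        using d(1) d(2)[of t] by (intro divide_left_mono mult_pos_pos) auto
      then show "norm (k t / (W t - s)) \<le> norm (1 / d * norm (k t))"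
        using d(1) by (simp add: norm_divide)
    qed
  qed measurable
  define D where "D = (LINT t|M. k t / (W t - s))"
  define K where "K = (LINT t|M. 2 / d\<^sup>2 * norm (k t))"
  have bound: "norm (((LINT t|M. h t / (W t - (s + e))) - (LINT t|M. h t / (W t - s))) / e - D) \<le> K * norm e"
    if e: "e \<noteq> 0" "norm e < d / 2" for e
  proof -
    have far: "d / 2 \<le> norm (W t - (s + e))" for t
      using norm_triangle_ineq2[of "W t - s" e] d(2)[of t] e by (simp add: diff_diff_eq)
    have nz': "W t - (s + e) \<noteq> 0" for t using far[of t] d(1) by auto
    \<comment> \<open>\<open>e * R\<close> is what is left of the integrand after the terms of order
      0 and 1 in \<open>e\<close>; for \<open>|e| < d / 2\<close> the shifted denominators still
      stay \<open>d / 2\<close> away from 0.\<close>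
    define R where "R t = e * (k t / (W t - s)) / (W t - (s + e))" for t
    have R_le: "norm (R t) \<le> norm e * (2 / d\<^sup>2 * norm (k t))" for t
    proof -
      have "norm (R t) = norm e * (norm (k t) / (norm (W t - s) * norm (W t - (s + e))))"
        by (simp add: R_def norm_mult norm_divide)
      also have "\<dots> \<le> norm e * (norm (k t) / (d * (d / 2)))"
        using d far[of t] nz[of t] nz'[of t]
        by (intro mult_left_mono divide_left_mono mult_mono mult_pos_pos) auto
      finally show ?thesis by (simp add: power2_eq_square field_simps)
    qed
    have [measurable]: "R \<in> borel_measurable M" unfolding R_def by measurable
    have Rint: "integrable M R"
      by (rule Bochner_Integration.integrable_bound[OF integrable_mult_right[OF integrable_mult_right[OF integrable_norm[OF k]]], of _ "norm e" "2 / d\<^sup>2"])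
         (use R_le d in \<open>auto intro!: AE_I2 simp: abs_mult\<close>)
    have "h t / (W t - (s + e)) = k t + e * (k t / (W t - s)) + e * R t" for t
      using nz[of t] nz'[of t] by (simp add: R_def k_def divide_simps) (simp add: algebra_simps)
    then have "(LINT t|M. h t / (W t - (s + e))) = (LINT t|M. k t + e * (k t / (W t - s)) + e * R t)"
      by simp
    also have "\<dots> = (LINT t|M. k t) + e * D + e * (LINT t|M. R t)"
    proof -
      have i: "integrable M (\<lambda>t. e * (k t / (W t - s)))" "integrable M (\<lambda>t. e * R t)"
        by (intro integrable_mult_right k2 Rint)+
      show ?thesis
        by (simp only: D_def integral_mult_right_zero Bochner_Integration.integral_add[OF k i(1)]
            Bochner_Integration.integral_add[OF Bochner_Integration.integrable_add[OF k i(1)] i(2)])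
    qed
    finally have "((LINT t|M. h t / (W t - (s + e))) - (LINT t|M. h t / (W t - s))) / e - D = (LINT t|M. R t)"
      using e by (simp add: k_def[abs_def] field_simps)
    also have "norm \<dots> \<le> (LINT t|M. norm e * (2 / d\<^sup>2 * norm (k t)))"
      by (rule order_trans[OF integral_norm_bound])
        (intro integral_mono integrable_norm integrable_mult_right Rint k R_le)
    also have "\<dots> = K * norm e" by (simp add: K_def mult.commute)
    finally show ?thesis .
  qed
  have "((\<lambda>e. ((LINT t|M. h t / (W t - (s + e))) - (LINT t|M. h t / (W t - s))) / e - D) \<longlongrightarrow> 0) (at 0)"
  proof (rule Lim_null_comparison)
    show "\<forall>\<^sub>F e in at 0. norm (((LINT t|M. h t / (W t - (s + e))) - (LINT t|M. h t / (W t - s))) / e - D) \<le> K * norm e"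
      unfolding eventually_at using d(1) bound by (intro exI[of _ "d / 2"]) (auto simp: dist_norm)
    show "((\<lambda>e. K * norm e) \<longlongrightarrow> 0) (at (0 :: complex))"
      by (auto intro!: tendsto_eq_intros)
  qed
  then have "((\<lambda>s. LINT t|M. h t / (W t - s)) has_field_derivative D) (at s)"
    unfolding DERIV_def by (simp add: LIM_zero_iff)
  then show ?thesis unfolding field_differentiable_def by blast
qed

text \<open>The constant \<open>c\<close> is a parameter because the denominator is bounded below in
  two ways: by angular separation on the rays, and by radial separation on the short sides of the
  contour.\<close>

lemma norm_ray_kernel_le:
  assumes "0 < c" "z \<noteq> 0" "c * (exp (Re \<omega>) + norm z)\<^sup>2 \<le> norm (exp (2 * \<omega>) - z\<^sup>2)"
  shows "norm (ray_kernel z \<omega>) \<le> 2 / c * (exp (2 * Re \<omega>) / (exp (Re \<omega>) + norm z)\<^sup>2)"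
proof -
  have pos: "0 < c * (exp (Re \<omega>) + norm z)\<^sup>2"
    using assms by (intro mult_pos_pos zero_less_power add_pos_pos) auto
  have "norm (ray_kernel z \<omega>) = 2 * exp (2 * Re \<omega>) / norm (exp (2 * \<omega>) - z\<^sup>2)"
    by (simp add: ray_kernel_def norm_divide norm_mult)
  also have "\<dots> \<le> 2 * exp (2 * Re \<omega>) / (c * (exp (Re \<omega>) + norm z)\<^sup>2)"
    using assms pos by (intro divide_left_mono mult_pos_pos) auto
  finally show ?thesis by (simp add: mult_ac)
qed

text \<open>A logarithmic distance of 1 separates the moduli by a factor \<open>e > 2\<close>, so
  the moduli alone bound the difference of squares. This covers the short sides of the Cauchy
  contour, which cross the angle of \<open>z\<close>, where the sine bound degenerates.\<close>

lemma norm_exp_diff_ge_far: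
  assumes z: "z \<noteq> 0" and "1 \<le> \<bar>Re \<omega> - ln (norm z)\<bar>"
  shows "1 / 8 * (exp (Re \<omega>) + norm z)\<^sup>2 \<le> norm (exp (2 * \<omega>) - z\<^sup>2)"
proof -
  define r where "r = exp (Re \<omega>)"
  define q where "q = norm z"
  have pos: "0 < r" "0 < q" using z by (auto simp: r_def q_def)
  have e: "2 \<le> exp (1 :: real)" using exp_ge_add_one_self[of 1] by simp
  have lnr: "ln r = Re \<omega>" by (simp add: r_def)
  have "2 * q \<le> r \<or> 2 * r \<le> q"
  proof (cases "ln q + 1 \<le> ln r")
    case True
    then have "exp (ln q) * exp 1 \<le> exp (ln r)" by (simp flip: exp_add)
    then have "q * exp 1 \<le> r" using pos by simp
    moreover have "q * 2 \<le> q * exp 1" using pos e by (intro mult_left_mono) auto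
    ultimately show ?thesis by simp
  next
    case False
    then have "ln r + 1 \<le> ln q" using assms(2) lnr by (simp add: q_def)
    then have "exp (ln r) * exp 1 \<le> exp (ln q)" by (simp flip: exp_add)
    then have "r * exp 1 \<le> q" using pos by simp
    moreover have "r * 2 \<le> r * exp 1" using pos e by (intro mult_left_mono) auto
    ultimately show ?thesis by simp
  qed
  then have "1 / 8 * (r + q)\<^sup>2 \<le> \<bar>r\<^sup>2 - q\<^sup>2\<bar>"
  proof
    assume "2 * q \<le> r"
    then have "(2 * q) * (2 * q) \<le> r * r" "(2 * q) * r \<le> r * r"
      using pos by (intro mult_mono; simp)+
    then show ?thesis by (simp add: power2_eq_square algebra_simps abs_if)
  next
    assume "2 * r \<le> q"
    then have "(2 * r) * (2 * r) \<le> q * q" "(2 * r) * q \<le> q * q"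
      using pos by (intro mult_mono; simp)+
    then show ?thesis by (simp add: power2_eq_square algebra_simps abs_if)
  qed
  also have "\<dots> \<le> norm (exp (2 * \<omega>) - z\<^sup>2)"
    using norm_triangle_ineq3[of "exp (2 * \<omega>)" "z\<^sup>2"]
    by (simp add: r_def q_def norm_power exp_double)
  finally show ?thesis by (simp add: r_def q_def)
qed

lemma integrable_exp_abs:
  fixes a u :: real
  assumes "0 < a"
  shows "integrable lborel (\<lambda>t. exp (- a * \<bar>t - u\<bar>))"
proof (rule integrableI_bounded)
  show "(\<integral>\<^sup>+t. ennreal (norm (exp (- a * \<bar>t - u\<bar>))) \<partial>lborel) < \<infinity>"
    using nn_integral_exp_abs_le[OF assms, of u] by (simp add: order_le_less_trans)
qed measurable

context wedge_function
begin

text \<open>The exponent of \<open>exp_kernel_le\<close> for \<open>s = 2 / p\<close>: the rate at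
  which the integrand on a ray decays in \<open>|t - ln |z||\<close>. Its positivity is where
  \<open>1 < p\<close> is decisive.\<close>

definition "decay = min (2 / p) (2 - 2 / p)"

lemma decay_pos: "0 < decay"
  using p by (simp add: decay_def field_simps)

text \<open>One pointwise majorant for both purposes: the convergence of the ray integrals and the
  vanishing of the short sides of the Cauchy contour.\<close>

lemma integrand_le:
  assumes "0 < c" "z \<noteq> 0" "c * (exp (Re \<omega>) + norm z)\<^sup>2 \<le> norm (exp (2 * \<omega>) - z\<^sup>2)"
    and "norm (f (exp \<omega>)) \<le> C * exp (- (2 / p) * Re \<omega>)" "0 \<le> C"
  shows "norm (f (exp \<omega>) * ray_kernel z \<omega>)
    \<le> 2 * C / c * norm z powr (- (2 / p)) * exp (- decay * \<bar>Re \<omega> - ln (norm z)\<bar>)"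
proof -
  have "norm (f (exp \<omega>) * ray_kernel z \<omega>)
      \<le> (C * exp (- (2 / p) * Re \<omega>)) * (2 / c * (exp (2 * Re \<omega>) / (exp (Re \<omega>) + norm z)\<^sup>2))"
    unfolding norm_mult using assms by (intro mult_mono norm_ray_kernel_le) auto
  also have "\<dots> = 2 * C / c * (exp ((2 - 2 / p) * Re \<omega>) / (exp (Re \<omega>) + norm z)\<^sup>2)"
  proof -
    have "exp ((2 - 2 / p) * Re \<omega>) = exp (- (2 / p) * Re \<omega>) * exp (2 * Re \<omega>)"
      by (simp add: exp_add[symmetric] algebra_simps)
    then show ?thesis by simp
  qed
  also have "\<dots> \<le> 2 * C / c * (norm z powr (- (2 / p)) * exp (- decay * \<bar>Re \<omega> - ln (norm z)\<bar>))"
    unfolding decay_def using assms p by (intro mult_left_mono exp_kernel_le) (auto simp: field_simps)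
  finally show ?thesis by (simp add: mult.assoc)
qed

lemma continuous_on_ray:
  assumes "\<alpha> < \<gamma>" "\<gamma> < \<beta>"
  shows "continuous_on A (\<lambda>t. f (exp (Complex t \<gamma>)))"
  by (rule continuous_on_compose2[OF holomorphic_on_imp_continuous_on[OF hol]])
     (use assms in \<open>auto intro!: continuous_intros wedgeI simp: Complex_eq\<close>)

lemma ray_measurable:
  assumes "\<alpha> < \<gamma>" "\<gamma> < \<beta>"
  shows "(\<lambda>t. f (exp (Complex t \<gamma>))) \<in> borel_measurable borel"
  using continuous_on_ray[OF assms] by (rule borel_measurable_continuous_onI)

text \<open>The sine condition keeps both poles \<open>z\<close> and \<open>- z\<close> off the ray;
  the exponential majorant of \<open>integrand_le\<close> does the rest.\<close>

lemma ray_integrable: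
  assumes \<gamma>: "\<alpha> < \<gamma>" "\<gamma> < \<beta>" and sin: "sin (Im \<zeta> - \<gamma>) \<noteq> 0"
  shows "integrable lborel (\<lambda>t. f (exp (Complex t \<gamma>)) * ray_kernel (exp \<zeta>) (Complex t \<gamma>))"
proof -
  obtain C where C: "0 \<le> C" "\<And>\<omega>. Im \<omega> \<in> {\<gamma>..\<gamma>} \<Longrightarrow> norm (f (exp \<omega>)) \<le> C * exp (- (2 / p) * Re \<omega>)"
    using growth[OF \<gamma>] by metis
  define c where "c = \<bar>sin (Im \<zeta> - \<gamma>)\<bar> / 2"
  have c: "0 < c" using sin by (simp add: c_def)
  define z where "z = exp \<zeta>"
  have z: "z \<noteq> 0" by (simp add: z_def)
  note [measurable] = ray_measurable[OF \<gamma>]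
  have [measurable]: "(\<lambda>t. Complex t \<gamma>) \<in> borel_measurable borel"
    by (intro borel_measurable_continuous_onI) (auto simp: Complex_eq intro!: continuous_intros)
  show ?thesis unfolding z_def[symmetric]
  proof (rule Bochner_Integration.integrable_bound)
    show "integrable lborel (\<lambda>t. 2 * C / c * norm z powr (- (2 / p)) * exp (- decay * \<bar>t - ln (norm z)\<bar>))"
      by (intro integrable_mult_right integrable_exp_abs decay_pos)
    show "AE t in lborel. norm (f (exp (Complex t \<gamma>)) * ray_kernel z (Complex t \<gamma>))
        \<le> norm (2 * C / c * norm z powr (- (2 / p)) * exp (- decay * \<bar>t - ln (norm z)\<bar>))"
    proof (intro AE_I2)
      fix t
      have "norm (f (exp (Complex t \<gamma>)) * ray_kernel z (Complex t \<gamma>))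
        \<le> 2 * C / c * norm z powr (- (2 / p)) * exp (- decay * \<bar>Re (Complex t \<gamma>) - ln (norm z)\<bar>)"
        using norm_exp_diff_ge[of "Complex t \<gamma>" \<zeta>] C(1) C(2)[of "Complex t \<gamma>"]
        by (intro integrand_le c z) (auto simp: c_def z_def mult.commute)
      then show "norm (f (exp (Complex t \<gamma>)) * ray_kernel z (Complex t \<gamma>))
        \<le> norm (2 * C / c * norm z powr (- (2 / p)) * exp (- decay * \<bar>t - ln (norm z)\<bar>))"
        unfolding complex.sel real_norm_def by (rule order_trans) (rule abs_ge_self)
    qed
  qed (auto simp: ray_kernel_def)
qed

text \<open>The kernel depends on \<open>z\<close> only through \<open>z^2\<close>, so the transform
  is a Cauchy transform in \<open>s = z^2\<close> composed with squaring.\<close>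

lemma ray_transform_differentiable:
  assumes \<gamma>: "\<alpha> < \<gamma>" "\<gamma> < \<beta>" and sin: "sin (Im \<zeta> - \<gamma>) \<noteq> 0"
  shows "ray_transform f \<gamma> field_differentiable at (exp \<zeta>)"
proof -
  define W where "W t = exp (2 * Complex t \<gamma>)" for t
  define h where "h t = f (exp (Complex t \<gamma>)) * (2 * W t)" for t
  define G where "G s = (LINT t|lborel. h t / (W t - s))" for s
  have [measurable]: "W \<in> borel_measurable borel"
    unfolding W_def by (intro borel_measurable_continuous_onI) (auto simp: Complex_eq intro!: continuous_intros)
  note [measurable] = ray_measurable[OF \<gamma>]
  have h [measurable]: "h \<in> borel_measurable borel" unfolding h_def by measurable
  have "G field_differentiable at ((exp \<zeta>)\<^sup>2)"
    unfolding G_def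
  proof (rule Cauchy_transform_differentiable)
    show "0 < (norm (exp \<zeta>))\<^sup>2 * \<bar>sin (Im \<zeta> - \<gamma>)\<bar> / 2" using sin by simp
    show "(norm (exp \<zeta>))\<^sup>2 * \<bar>sin (Im \<zeta> - \<gamma>)\<bar> / 2 \<le> norm (W t - (exp \<zeta>)\<^sup>2)" for t
    proof -
      have "(norm (exp \<zeta>))\<^sup>2 * \<bar>sin (Im \<zeta> - \<gamma>)\<bar> \<le> (exp t + norm (exp \<zeta>))\<^sup>2 * \<bar>sin (Im \<zeta> - \<gamma>)\<bar>"
        by (intro mult_right_mono power_mono) auto
      then show ?thesis using norm_exp_diff_ge[of "Complex t \<gamma>" \<zeta>] by (simp add: W_def)
    qed
    show "integrable lborel (\<lambda>t. h t / (W t - (exp \<zeta>)\<^sup>2))"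
      using ray_integrable[OF assms] by (simp add: h_def W_def ray_kernel_def mult.assoc)
  qed (auto simp: h)
  then have "(G \<circ> (\<lambda>z. z\<^sup>2)) field_differentiable at (exp \<zeta>)"
    by (intro field_differentiable_compose derivative_intros) auto
  also have "G \<circ> (\<lambda>z. z\<^sup>2) = ray_transform f \<gamma>"
    by (auto simp: fun_eq_iff G_def h_def W_def ray_transform_def ray_kernel_def mult.assoc)
  finally show ?thesis .
qed

end

subsection \<open>Cauchy's formula on a wedge\<close>

lemma has_contour_integral_horizontal:
  assumes "((\<lambda>t. g (Complex t c)) has_integral I) {a..b}" "a < b"
  shows "(g has_contour_integral I) (linepath (Complex a c) (Complex b c))"
proof -
  have eq: "linepath (Complex a c) (Complex b c) x = Complex ((b - a) *\<^sub>R x + a) c" for x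
    by (simp add: linepath_def complex_eq_iff algebra_simps)
  have "(\<lambda>x. (x - a) / (b - a)) ` {a..b} = {0..1}"
  proof (intro equalityI subsetI)
    fix x assume "x \<in> {0..1::real}"
    then have "(b - a) * x \<le> b - a" "0 \<le> (b - a) * x"
      using assms(2) by (auto intro: mult_left_le)
    then have "(b - a) * x + a \<in> {a..b}" unfolding atLeastAtMost_iff by linarith
    then show "x \<in> (\<lambda>x. (x - a) / (b - a)) ` {a..b}"
      using assms(2) by (intro image_eqI[of _ _ "(b - a) * x + a"]) auto
  qed (use assms(2) in auto)
  then have "((\<lambda>x. g (Complex ((b - a) *\<^sub>R x + a) c)) has_integral (1 / (b - a)) *\<^sub>R I) {0..1}"
    using has_integral_affinity[of "\<lambda>t. g (Complex t c)" I a b "b - a" a] assms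
    by (simp add: diff_divide_distrib)
  then have "((\<lambda>x. g (Complex ((b - a) *\<^sub>R x + a) c) * of_real (b - a)) has_integral
      (1 / (b - a)) *\<^sub>R I * of_real (b - a)) {0..1}"
    by (rule has_integral_mult_left)
  moreover have "(1 / (b - a)) *\<^sub>R I * of_real (b - a) = I"
    using assms(2) by (simp add: scaleR_conv_of_real)
  moreover have "Complex b c - Complex a c = of_real (b - a)"
    by (simp add: complex_eq_iff)
  ultimately show ?thesis
    unfolding has_contour_integral_linepath eq by simp
qed

lemma tendsto_LINT_symmetric_interval:
  fixes g :: "real \<Rightarrow> complex"
  assumes int: "integrable lborel g" and cont: "continuous_on UNIV g"
  shows "(\<lambda>n. integral {- real n..real n} g) \<longlonglongrightarrow> (LINT t|lborel. g t)"
proof -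
  have "set_integrable lborel {- real n..real n} g" for n
    by (rule borel_integrable_atLeastAtMost') (rule continuous_on_subset[OF cont], simp)
  then have eq: "integral {- real n..real n} g = (LINT t|lborel. indicator {- real n..real n} t *\<^sub>R g t)" for n
    by (subst set_borel_integral_eq_integral(2)[symmetric]) (auto simp: set_lebesgue_integral_def)
  show ?thesis unfolding eq
  proof (rule integral_dominated_convergence[where w = "\<lambda>t. norm (g t)"])
    show "AE t in lborel. (\<lambda>n. indicator {- real n..real n} t *\<^sub>R g t) \<longlonglongrightarrow> g t"
    proof (intro AE_I2 tendsto_eventually)
      fix t :: real
      obtain n0 where "\<bar>t\<bar> \<le> real n0" using real_arch_simple by blast
      then show "\<forall>\<^sub>F n in sequentially. indicator {- real n..real n} t *\<^sub>R g t = g t"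
        by (intro eventually_sequentiallyI[of n0]) (auto simp: abs_le_iff)
    qed
  qed (use int in \<open>auto intro!: AE_I2 split: split_indicator\<close>)
qed

context wedge_function
begin

text \<open>The line integral becomes an area integral: \<open>|f|\<close> at each point of the ray
  is averaged over a ball of radius \<open>\<kappa> * exp t\<close>, on which
  \<open>|w| + \<rho>\<close> is comparable to \<open>exp t + \<rho>\<close>, and by Fubini each
  \<open>w\<close> is counted only for \<open>t\<close> in an interval of length 2.\<close>

lemma ray_integral_le:
  assumes \<gamma>: "\<alpha> < \<gamma>" "\<gamma> < \<beta>"
  obtains C where "0 < C" "\<And>\<rho>. 0 < \<rho> \<Longrightarrow>
    (\<integral>\<^sup>+t. ennreal (norm (f (exp (Complex t \<gamma>))) * (exp (2 * t) / (exp t + \<rho>)\<^sup>2)) \<partial>lborel)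
      \<le> ennreal C * (\<integral>\<^sup>+w. ennreal (f0 w / (norm w + \<rho>)\<^sup>2) \<partial>lborel)"
proof -
  obtain \<kappa> where \<kappa>: "0 < \<kappa>" "\<kappa> \<le> 1 / 2"
    "\<And>\<omega>. Im \<omega> \<in> {\<gamma>..\<gamma>} \<Longrightarrow> ball (exp \<omega>) (\<kappa> * exp (Re \<omega>)) \<subseteq> wedge \<alpha> \<beta>"
    using cone_margin[OF \<gamma>] by metis
  \<comment> \<open>12 from the mean value inequality, as in \<open>c\<close> below, times 4 from
    squaring \<open>|w| + \<rho> <= 2 * (exp t + \<rho>)\<close>. Fubini contributes the further
    factor 2.\<close>
  define C where "C = 48 / \<kappa>\<^sup>2"
  have C0: "0 \<le> C" by (simp add: C_def)
  have "(\<integral>\<^sup>+t. ennreal (norm (f (exp (Complex t \<gamma>))) * (exp (2 * t) / (exp t + \<rho>)\<^sup>2)) \<partial>lborel)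
      \<le> ennreal (C * 2) * (\<integral>\<^sup>+w. ennreal (f0 w / (norm w + \<rho>)\<^sup>2) \<partial>lborel)" if \<rho>: "0 < \<rho>" for \<rho>
  proof -
    define J where "J w = f0 w / (norm w + \<rho>)\<^sup>2" for w
    have [measurable]: "J \<in> borel_measurable borel" unfolding J_def by measurable
    have J0: "0 \<le> J w" for w by (simp add: J_def)
    \<comment> \<open>An annulus that contains the ball about
      \<open>exp (Complex t \<gamma>)\<close>: as \<open>\<kappa> <= 1 / 2\<close>, the moduli in
      the ball lie between half and three halves of \<open>exp t\<close>. Unlike membership in the
      ball, the condition is easily solved for \<open>t\<close>.\<close>
    define A where "A w t \<longleftrightarrow> exp (t - 1) \<le> norm w \<and> norm w \<le> exp (t + 1)" for w :: complex and t :: real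
    have [measurable]: "Measurable.pred (borel \<Otimes>\<^sub>M borel) (\<lambda>x. A (fst x) (snd x))"
      "Measurable.pred (borel \<Otimes>\<^sub>M borel) (\<lambda>x. A (snd x) (fst x))"
      "Measurable.pred borel (A w)" "Measurable.pred borel (\<lambda>w. A w t)" for w t
      unfolding A_def by measurable
    have pt: "ennreal (norm (f (exp (Complex t \<gamma>))) * (exp (2 * t) / (exp t + \<rho>)\<^sup>2))
        \<le> ennreal C * (\<integral>\<^sup>+w. ennreal (J w) * of_bool (A w t) \<partial>lborel)" for t
    proof -
      define B where "B = ball (exp (Complex t \<gamma>)) (\<kappa> * exp t)"
      have [measurable]: "B \<in> sets borel" by (simp add: B_def)
      define c where "c = 12 / (\<kappa>\<^sup>2 * (exp t + \<rho>)\<^sup>2)"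
      have pos: "0 < exp t + \<rho>" using \<rho> by (simp add: add_pos_pos)
      then have c: "0 \<le> c" by (simp add: c_def)
      have near: "A w t \<and> c * f0 w \<le> C * J w" if w: "w \<in> B" for w
      proof -
        have "norm (exp (Complex t \<gamma>) - w) \<le> 1 / 2 * exp t"
        proof -
          have "\<kappa> * exp t \<le> 1 / 2 * exp t" using \<kappa>(2) by (intro mult_right_mono) auto
          moreover have "norm (exp (Complex t \<gamma>) - w) < \<kappa> * exp t" using w by (simp add: B_def dist_norm)
          ultimately show ?thesis by linarith
        qed
        then have *: "norm w \<le> 3 / 2 * exp t" "1 / 2 * exp t \<le> norm w"
          using norm_triangle_ineq3[of "exp (Complex t \<gamma>)" w] unfolding abs_le_iff norm_exp_eq_Re complex.sel
          by linarith+
        have e: "2 \<le> exp (1 :: real)" using exp_ge_add_one_self[of 1] by simp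
        have "norm w \<le> exp 1 * exp t"
          using *(1) mult_right_mono[OF e, of "exp t"] exp_gt_zero[of t] by linarith
        moreover have "exp t \<le> exp 1 * norm w"
          using *(2) mult_right_mono[OF e, of "norm w"] by simp
        moreover have "exp (t - 1) * exp 1 = exp t" by (simp flip: exp_add)
        ultimately have "A w t"
          unfolding A_def exp_add using mult_right_le_imp_le[of "exp (t - 1)" "exp 1" "norm w"]
          by (simp add: mult.commute)
        moreover have "c * f0 w * (norm w + \<rho>)\<^sup>2 \<le> C * f0 w"
        proof -
          have "norm w + \<rho> \<le> 2 * (exp t + \<rho>)"
            using *(1) \<rho> exp_gt_zero[of t] unfolding distrib_left by linarith
          then have "(norm w + \<rho>)\<^sup>2 \<le> (2 * (exp t + \<rho>))\<^sup>2"
            using \<rho> by (intro power_mono) auto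
          then have "c * f0 w * (norm w + \<rho>)\<^sup>2 \<le> c * f0 w * (2 * (exp t + \<rho>))\<^sup>2"
            using c by (intro mult_left_mono) auto
          also have "\<dots> = C * f0 w"
            unfolding power_mult_distrib c_def C_def using pos by simp
          finally show ?thesis .
        qed
        moreover have "0 < (norm w + \<rho>)\<^sup>2"
          using \<rho> norm_ge_zero[of w] by (intro zero_less_power) linarith
        ultimately show ?thesis
          by (simp only: J_def times_divide_eq_right pos_le_divide_eq simp_thms)
      qed
      have "norm (f (exp (Complex t \<gamma>))) * (exp (2 * t) / (exp t + \<rho>)\<^sup>2)
          = c * (norm (f (exp (Complex t \<gamma>))) * (\<kappa> * exp t / 2)\<^sup>2 / 3)"
        using \<kappa>(1) pos by (simp add: c_def power_mult_distrib power_divide exp_double)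
      also have "ennreal \<dots> = ennreal c * ennreal (norm (f (exp (Complex t \<gamma>))) * (\<kappa> * exp t / 2)\<^sup>2 / 3)"
        using c by (rule ennreal_mult')
      also have "\<dots> \<le> ennreal c * (\<integral>\<^sup>+w. ennreal (f0 w * indicator B w) \<partial>lborel)"
        using mean_value_bound[OF \<kappa>(3) \<kappa>(1), of "Complex t \<gamma>"]
        by (intro mult_left_mono) (auto simp: B_def)
      also have "\<dots> = (\<integral>\<^sup>+w. ennreal c * ennreal (f0 w * indicator B w) \<partial>lborel)"
        by (rule nn_integral_cmult[symmetric]) measurable
      also have "\<dots> \<le> (\<integral>\<^sup>+w. ennreal C * (ennreal (J w) * of_bool (A w t)) \<partial>lborel)"
      proof (intro nn_integral_mono)
        fix w
        show "ennreal c * ennreal (f0 w * indicator B w) \<le> ennreal C * (ennreal (J w) * of_bool (A w t))"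
        proof (cases "w \<in> B")
          case True
          have "ennreal (c * f0 w) \<le> ennreal (C * J w)" using near[OF True] by (intro ennreal_leI) simp
          then show ?thesis
            using near[OF True] True c C0 by (simp add: ennreal_mult J0)
        qed simp
      qed
      also have "\<dots> = ennreal C * (\<integral>\<^sup>+w. ennreal (J w) * of_bool (A w t) \<partial>lborel)"
        by (rule nn_integral_cmult) measurable
      finally show ?thesis .
    qed
    have "(\<integral>\<^sup>+t. ennreal (norm (f (exp (Complex t \<gamma>))) * (exp (2 * t) / (exp t + \<rho>)\<^sup>2)) \<partial>lborel)
        \<le> (\<integral>\<^sup>+t. ennreal C * (\<integral>\<^sup>+w. ennreal (J w) * of_bool (A w t) \<partial>lborel) \<partial>lborel)"
      by (intro nn_integral_mono pt)
    also have "\<dots> = ennreal C * (\<integral>\<^sup>+t. (\<integral>\<^sup>+w. ennreal (J w) * of_bool (A w t) \<partial>lborel) \<partial>lborel)"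
      by (rule nn_integral_cmult) measurable
    also have "(\<integral>\<^sup>+t. (\<integral>\<^sup>+w. ennreal (J w) * of_bool (A w t) \<partial>lborel) \<partial>lborel)
        = (\<integral>\<^sup>+w. (\<integral>\<^sup>+t. ennreal (J w) * of_bool (A w t) \<partial>lborel) \<partial>lborel)"
      by (rule lborel_pair.Fubini') measurable
    also have "\<dots> \<le> (\<integral>\<^sup>+w. ennreal (J w) * 2 \<partial>lborel)"
    proof (intro nn_integral_mono)
      fix w :: complex
      show "(\<integral>\<^sup>+t. ennreal (J w) * of_bool (A w t) \<partial>lborel) \<le> ennreal (J w) * 2"
      proof (cases "w = 0")
        case True
        then show ?thesis by (simp add: J_def f0_def zero_notin_wedge)
      next
        case False
        have "t \<in> {ln (norm w) - 1..ln (norm w) + 1}" if "A w t" for t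
        proof -
          have "exp (t - 1) \<le> exp (ln (norm w))" "exp (ln (norm w)) \<le> exp (t + 1)"
            using that False by (auto simp: A_def)
          then show ?thesis unfolding exp_le_cancel_iff by simp
        qed
        then have "(\<integral>\<^sup>+t. ennreal (J w) * of_bool (A w t) \<partial>lborel)
            \<le> (\<integral>\<^sup>+t. ennreal (J w) * indicator {ln (norm w) - 1..ln (norm w) + 1} t \<partial>lborel)"
          by (intro nn_integral_mono mult_left_mono) (auto simp: of_bool_def)
        also have "\<dots> = ennreal (J w) * 2"
          by (simp add: nn_integral_cmult_indicator)
        finally show ?thesis .
      qed
    qed
    also have "\<dots> = 2 * (\<integral>\<^sup>+w. ennreal (J w) \<partial>lborel)"
      by (simp add: nn_integral_multc mult.commute)
    finally have "(\<integral>\<^sup>+t. ennreal (norm (f (exp (Complex t \<gamma>))) * (exp (2 * t) / (exp t + \<rho>)\<^sup>2)) \<partial>lborel)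
        \<le> ennreal C * (2 * (\<integral>\<^sup>+w. ennreal (J w) \<partial>lborel))"
      by (simp add: mult_left_mono)
    also have "\<dots> = ennreal (C * 2) * (\<integral>\<^sup>+w. ennreal (J w) \<partial>lborel)"
      using ennreal_mult'[OF C0, of 2] by (simp add: mult.assoc)
    finally show ?thesis by (simp only: J_def)
  qed
  moreover have "0 < C * 2" using \<kappa>(1) by (simp add: C_def)
  ultimately show thesis using that by blast
qed

text \<open>The gap \<open>\<delta>\<close> in the sine keeps \<open>\<zeta>\<close> away from the
  angle of the ray and of its reflection, so that one constant serves all such
  \<open>\<zeta>\<close>.\<close>

lemma ray_transform_le:
  assumes \<gamma>: "\<alpha> < \<gamma>" "\<gamma> < \<beta>" and \<delta>: "0 < \<delta>"
  obtains C where "0 < C" "\<And>\<zeta>. \<delta> \<le> \<bar>sin (Im \<zeta> - \<gamma>)\<bar> \<Longrightarrow>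
    ennreal (norm (ray_transform f \<gamma> (exp \<zeta>)))
      \<le> ennreal C * (\<integral>\<^sup>+w. ennreal (f0 w / (norm w + norm (exp \<zeta>))\<^sup>2) \<partial>lborel)"
proof -
  obtain C where C: "0 < C" "\<And>\<rho>. 0 < \<rho> \<Longrightarrow>
    (\<integral>\<^sup>+t. ennreal (norm (f (exp (Complex t \<gamma>))) * (exp (2 * t) / (exp t + \<rho>)\<^sup>2)) \<partial>lborel)
      \<le> ennreal C * (\<integral>\<^sup>+w. ennreal (f0 w / (norm w + \<rho>)\<^sup>2) \<partial>lborel)"
    by (rule ray_integral_le[OF \<gamma>]) blast
  have "ennreal (norm (ray_transform f \<gamma> (exp \<zeta>)))
      \<le> ennreal (4 / \<delta> * C) * (\<integral>\<^sup>+w. ennreal (f0 w / (norm w + norm (exp \<zeta>))\<^sup>2) \<partial>lborel)"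
    if \<zeta>: "\<delta> \<le> \<bar>sin (Im \<zeta> - \<gamma>)\<bar>" for \<zeta>
  proof -
    define z where "z = exp \<zeta>"
    have z: "0 < norm z" by (simp add: z_def)
    note [measurable] = ray_measurable[OF \<gamma>]
    have "integrable lborel (\<lambda>t. f (exp (Complex t \<gamma>)) * ray_kernel z (Complex t \<gamma>))"
      unfolding z_def using \<zeta> \<delta> by (intro ray_integrable \<gamma>) auto
    then have "ennreal (norm (ray_transform f \<gamma> z))
        \<le> (\<integral>\<^sup>+t. ennreal (norm (f (exp (Complex t \<gamma>)) * ray_kernel z (Complex t \<gamma>))) \<partial>lborel)"
      unfolding ray_transform_def by (rule integral_norm_bound_ennreal)
    also have "\<dots> \<le> (\<integral>\<^sup>+t. ennreal (4 / \<delta>) *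
        ennreal (norm (f (exp (Complex t \<gamma>))) * (exp (2 * t) / (exp t + norm z)\<^sup>2)) \<partial>lborel)"
    proof (intro nn_integral_mono)
      fix t
      have "\<delta> / 2 * (exp t + norm z)\<^sup>2 \<le> (exp t + norm z)\<^sup>2 * \<bar>sin (Im \<zeta> - \<gamma>)\<bar> / 2"
        using mult_left_mono[OF \<zeta>, of "(exp t + norm z)\<^sup>2"] by (simp add: mult.commute)
      also have "\<dots> \<le> norm (exp (2 * Complex t \<gamma>) - z\<^sup>2)"
        using norm_exp_diff_ge[of "Complex t \<gamma>" \<zeta>] by (simp add: z_def)
      finally have "norm (ray_kernel z (Complex t \<gamma>)) \<le> 2 / (\<delta> / 2) * (exp (2 * t) / (exp t + norm z)\<^sup>2)"
        using norm_ray_kernel_le[of "\<delta> / 2" z "Complex t \<gamma>"] \<delta> z by simp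
      then have "norm (f (exp (Complex t \<gamma>))) * norm (ray_kernel z (Complex t \<gamma>))
          \<le> norm (f (exp (Complex t \<gamma>))) * (2 / (\<delta> / 2) * (exp (2 * t) / (exp t + norm z)\<^sup>2))"
        by (intro mult_left_mono) auto
      then have "norm (f (exp (Complex t \<gamma>)) * ray_kernel z (Complex t \<gamma>))
          \<le> 4 / \<delta> * (norm (f (exp (Complex t \<gamma>))) * (exp (2 * t) / (exp t + norm z)\<^sup>2))"
        by (simp add: norm_mult mult_ac)
      then show "ennreal (norm (f (exp (Complex t \<gamma>)) * ray_kernel z (Complex t \<gamma>)))
          \<le> ennreal (4 / \<delta>) * ennreal (norm (f (exp (Complex t \<gamma>))) * (exp (2 * t) / (exp t + norm z)\<^sup>2))"
        using \<delta> by (subst ennreal_mult'[symmetric]) (auto intro!: ennreal_leI)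
    qed
    also have "\<dots> = ennreal (4 / \<delta>) *
        (\<integral>\<^sup>+t. ennreal (norm (f (exp (Complex t \<gamma>))) * (exp (2 * t) / (exp t + norm z)\<^sup>2)) \<partial>lborel)"
      by (rule nn_integral_cmult) measurable
    also have "\<dots> \<le> ennreal (4 / \<delta>) * (ennreal C * (\<integral>\<^sup>+w. ennreal (f0 w / (norm w + norm z)\<^sup>2) \<partial>lborel))"
      by (intro mult_left_mono C z) auto
    also have "\<dots> = ennreal (4 / \<delta> * C) * (\<integral>\<^sup>+w. ennreal (f0 w / (norm w + norm z)\<^sup>2) \<partial>lborel)"
      using \<delta> C by (subst mult.assoc[symmetric], subst ennreal_mult[symmetric]) auto
    finally show ?thesis by (simp only: z_def)
  qed
  moreover have "0 < 4 / \<delta> * C" using \<delta> C by simp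
  ultimately show thesis using that by blast
qed

end

lemma sin_abs_le: "sin \<bar>u\<bar> \<le> \<bar>sin (u :: real)\<bar>"
  by (cases "0 \<le> u") auto

lemma sin_nonzero: "0 < \<bar>u\<bar> \<Longrightarrow> \<bar>u\<bar> < pi \<Longrightarrow> sin (u :: real) \<noteq> 0"
  using sin_gt_zero[of "\<bar>u\<bar>"] sin_abs_le[of u] by auto

context wedge_function
begin

text \<open>In the variable \<open>\<omega>\<close> the two rays are horizontal lines, and Cauchy's
  formula is applied to the rectangles between them with real parts from \<open>- n\<close> to
  \<open>n\<close>. The short sides vanish in the limit by the decay of the integrand, and dominated
  convergence turns the long sides into the two transforms.\<close>

lemma ray_transform_Cauchy:
  assumes "\<alpha> < \<alpha>1" "\<alpha>1 < Im \<zeta>" "Im \<zeta> < \<alpha>2" "\<alpha>2 < \<beta>"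
  shows "ray_transform f \<alpha>1 (exp \<zeta>) - ray_transform f \<alpha>2 (exp \<zeta>) = 2 * pi * \<i> * f (exp \<zeta>)"
proof -
  define z where "z = exp \<zeta>"
  define L where "L = ln (norm z)"
  have L: "L = Re \<zeta>" by (simp add: L_def z_def)
  define S where "S = {\<omega>. \<alpha> < Im \<omega> \<and> Im \<omega> < \<beta>}"
  have S: "open S" "convex S" by (simp_all add: S_def open_strip convex_strip)
  have \<zeta>S: "\<zeta> \<in> S" using assms by (simp add: S_def)
  define F where "F \<omega> = f (exp \<omega>) * ray_kernel z \<omega>" for \<omega>
  define E where "E \<omega> = exp (2 * \<omega>)" for \<omega> :: complex
  \<comment> \<open>The simple zero of \<open>exp (2 * \<omega>) - z^2\<close> at
    \<open>\<zeta>\<close> is divided out, so that \<open>F = g / (\<omega> - \<zeta>)\<close> off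
    \<open>\<zeta>\<close>, with \<open>g\<close> below holomorphic on the whole strip and
    \<open>g \<zeta> = f z\<close>.\<close>
  define q where "q \<omega> = (if \<omega> = \<zeta> then deriv E \<zeta> else (E \<omega> - E \<zeta>) / (\<omega> - \<zeta>))" for \<omega>
  have dE: "deriv E \<zeta> = 2 * exp (2 * \<zeta>)"
    unfolding E_def by (intro DERIV_imp_deriv) (auto intro!: derivative_eq_intros)
  have "E holomorphic_on UNIV" unfolding E_def by (intro holomorphic_intros)
  then have holq: "q holomorphic_on S"
    unfolding q_def using pole_lemma_open[of E UNIV \<zeta>] by (auto intro: holomorphic_on_subset)
  \<comment> \<open>The strip is narrower than \<open>pi\<close>, so doubling keeps imaginary parts
    less than \<open>2 * pi\<close> apart; in particular the reflected pole \<open>- z\<close> has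
    no logarithm in the strip.\<close>
  have E_inj: "E \<omega> \<noteq> E \<zeta>" if "\<omega> \<in> S" "\<omega> \<noteq> \<zeta>" for \<omega>
  proof
    assume "E \<omega> = E \<zeta>"
    then have eq: "exp (2 * \<omega>) = exp (2 * \<zeta>)" by (simp only: E_def)
    have "\<bar>Im (2 * \<omega>) - Im (2 * \<zeta>)\<bar> < 2 * pi"
      using that \<zeta>S angle by (simp add: S_def) linarith
    then have "2 * \<omega> = 2 * \<zeta>" using eq by (rule exp_complex_eqI)
    then show False using that by simp
  qed
  have q_nz: "q \<omega> \<noteq> 0" if "\<omega> \<in> S" for \<omega>
    using that E_inj[of \<omega>] by (auto simp: q_def dE)
  define g where "g \<omega> = f (exp \<omega>) * (2 * E \<omega>) / q \<omega>" for \<omega>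
  have holfexp: "(\<lambda>\<omega>. f (exp \<omega>)) holomorphic_on S"
    using holomorphic_on_compose_gen[OF holomorphic_on_exp hol, of S]
    by (auto simp: o_def S_def intro: wedgeI)
  have holg: "g holomorphic_on S"
    unfolding g_def E_def by (intro holomorphic_intros holfexp holq q_nz)
  have gF: "g \<omega> / (\<omega> - \<zeta>) = F \<omega>" if "\<omega> \<noteq> \<zeta>" for \<omega>
    using that by (simp add: g_def F_def q_def ray_kernel_def E_def z_def exp_double)
  have g\<zeta>: "g \<zeta> = f z" by (simp add: g_def q_def dE E_def z_def)
  have contF: "continuous_on (S - {\<zeta>}) F"
  proof -
    have "continuous_on (S - {\<zeta>}) (\<lambda>\<omega>. g \<omega> / (\<omega> - \<zeta>))"
      by (intro continuous_intros continuous_on_subset[OF holomorphic_on_imp_continuous_on[OF holg]]) auto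
    then show ?thesis by (rule continuous_on_eq) (simp add: gF)
  qed
  obtain C where C: "0 \<le> C" "\<And>\<omega>. Im \<omega> \<in> {\<alpha>1..\<alpha>2} \<Longrightarrow> norm (f (exp \<omega>)) \<le> C * exp (- (2 / p) * Re \<omega>)"
    using growth[OF assms(1,4)] by metis
  define K where "K = 2 * C / (1 / 8) * norm z powr (- (2 / p))"
  have K: "0 \<le> K" using C by (simp add: K_def)
  define b where "b n = K * exp (- decay * (real n - \<bar>L\<bar>))" for n
  have F_le: "norm (F \<omega>) \<le> b n"
    if "Im \<omega> \<in> {\<alpha>1..\<alpha>2}" "\<bar>Re \<omega>\<bar> = real n" "\<bar>L\<bar> + 1 \<le> real n" for \<omega> n
  proof -
    have "norm (F \<omega>) \<le> 2 * C / (1 / 8) * norm z powr (- (2 / p)) * exp (- decay * \<bar>Re \<omega> - ln (norm z)\<bar>)"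
      unfolding F_def using that C
      by (intro integrand_le norm_exp_diff_ge_far) (auto simp: z_def L_def abs_if split: if_splits)
    also have "\<dots> \<le> b n"
      unfolding b_def K_def using that decay_pos K[unfolded K_def]
      by (intro mult_left_mono) (auto simp: L_def)
    finally show ?thesis .
  qed
  define I where "I \<gamma> n = integral {- real n..real n} (\<lambda>t. F (Complex t \<gamma>))" for \<gamma> n
  have contray: "continuous_on A (\<lambda>t. F (Complex t \<gamma>))" if "\<gamma> \<in> {\<alpha>1, \<alpha>2}" for A \<gamma>
    by (rule continuous_on_compose2[OF contF])
       (use that assms in \<open>auto simp: S_def Complex_eq intro!: continuous_intros\<close>)
  \<comment> \<open>The bound \<open>|L| + 1 <= n\<close> serves twice: \<open>\<zeta>\<close> lies
    inside the rectangle, and the short sides have logarithmic distance at least 1 from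
    \<open>z\<close>.\<close>
  have ev: "norm (I \<alpha>1 n - I \<alpha>2 n - 2 * pi * \<i> * f z) \<le> 2 * ((\<alpha>2 - \<alpha>1) * b n)"
    if n: "\<bar>L\<bar> + 1 \<le> real n" for n
  proof -
    define A1 A2 A3 A4 where "A1 = Complex (- real n) \<alpha>1" and "A2 = Complex (real n) \<alpha>1"
      and "A3 = Complex (real n) \<alpha>2" and "A4 = Complex (- real n) \<alpha>2"
    note A_defs = A1_def A2_def A3_def A4_def
    have npos: "- real n < real n" using n by simp
    have sub: "closed_segment A1 A2 \<subseteq> S - {\<zeta>}" "closed_segment A2 A3 \<subseteq> S - {\<zeta>}"
      "closed_segment A3 A4 \<subseteq> S - {\<zeta>}" "closed_segment A4 A1 \<subseteq> S - {\<zeta>}"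
      using assms n by (auto simp: A_defs closed_segment_same_Re closed_segment_same_Im closed_segment_eq_real_ivl S_def L split: if_splits)
    have ints: "F contour_integrable_on linepath A1 A2" "F contour_integrable_on linepath A2 A3"
      "F contour_integrable_on linepath A3 A4" "F contour_integrable_on linepath A4 A1"
      using sub by (auto intro!: contour_integrable_continuous_linepath continuous_on_subset[OF contF])
    have rect: "rectpath A1 A3 = linepath A1 A2 +++ linepath A2 A3 +++ linepath A3 A4 +++ linepath A4 A1"
      by (simp add: rectpath_def A_defs Let_def)
    have image: "path_image (rectpath A1 A3) \<subseteq> S - {\<zeta>}"
      unfolding rect using sub by (auto simp: path_image_join)
    have "\<zeta> \<in> box A1 A3"
      using assms n by (auto simp: A_defs in_box_complex_iff L)
    then have wn: "winding_number (rectpath A1 A3) \<zeta> = 1"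
      by (rule winding_number_rectpath)
    have "((\<lambda>\<omega>. g \<omega> / (\<omega> - \<zeta>)) has_contour_integral (2 * pi * \<i> * winding_number (rectpath A1 A3) \<zeta> * g \<zeta>)) (rectpath A1 A3)"
      using S \<zeta>S image by (intro Cauchy_integral_formula_convex_simple[OF S(2) holg]) (auto simp: interior_open)
    then have "(F has_contour_integral (2 * pi * \<i> * f z)) (rectpath A1 A3)"
      unfolding wn g\<zeta> mult_1_right
      by (rule has_contour_integral_eq) (use image gF in auto)
    then have "contour_integral (rectpath A1 A3) F = 2 * pi * \<i> * f z"
      by (rule contour_integral_unique)
    moreover have "contour_integral (rectpath A1 A3) F = contour_integral (linepath A1 A2) F
        + (contour_integral (linepath A2 A3) F + (contour_integral (linepath A3 A4) F + contour_integral (linepath A4 A1) F))"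
      unfolding rect using ints by (simp add: contour_integrable_joinI)
    moreover have "contour_integral (linepath A1 A2) F = I \<alpha>1 n"
      unfolding A_defs I_def using npos contray
      by (intro contour_integral_unique has_contour_integral_horizontal integrable_integral integrable_continuous_real) auto
    moreover have "contour_integral (linepath A4 A3) F = I \<alpha>2 n"
      unfolding A_defs I_def using npos contray
      by (intro contour_integral_unique has_contour_integral_horizontal integrable_integral integrable_continuous_real) auto
    moreover have "contour_integral (linepath A3 A4) F = - contour_integral (linepath A4 A3) F"
      by (rule contour_integral_reverse_linepath) (rule continuous_on_subset[OF contF sub(3)])
    ultimately have eq: "I \<alpha>1 n - I \<alpha>2 n - 2 * pi * \<i> * f z
        = - (contour_integral (linepath A2 A3) F + contour_integral (linepath A4 A1) F)"
      by (simp add: algebra_simps)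
    have "0 \<le> b n" using K by (simp add: b_def)
    have nA: "norm (A3 - A2) = \<alpha>2 - \<alpha>1" "norm (A1 - A4) = \<alpha>2 - \<alpha>1"
      using assms by (simp_all add: A_defs cmod_def)
    have "norm (contour_integral (linepath A2 A3) F) \<le> b n * norm (A3 - A2)"
    proof (rule contour_integral_bound_linepath[OF ints(2) \<open>0 \<le> b n\<close>])
      fix x assume "x \<in> closed_segment A2 A3"
      then show "norm (F x) \<le> b n"
        using n assms by (intro F_le) (auto simp: A_defs closed_segment_same_Re closed_segment_eq_real_ivl split: if_splits)
    qed
    moreover have "norm (contour_integral (linepath A4 A1) F) \<le> b n * norm (A1 - A4)"
    proof (rule contour_integral_bound_linepath[OF ints(4) \<open>0 \<le> b n\<close>])
      fix x assume "x \<in> closed_segment A4 A1"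
      then show "norm (F x) \<le> b n"
        using n assms by (intro F_le) (auto simp: A_defs closed_segment_same_Re closed_segment_eq_real_ivl split: if_splits)
    qed
    ultimately show ?thesis
      unfolding eq norm_minus_cancel nA
      using norm_triangle_ineq[of "contour_integral (linepath A2 A3) F" "contour_integral (linepath A4 A1) F"]
      by (simp add: mult.commute)
  qed
  have b0: "(\<lambda>n. 2 * ((\<alpha>2 - \<alpha>1) * b n)) \<longlonglongrightarrow> 0"
  proof -
    have "(\<lambda>n. exp (- decay * real n)) \<longlonglongrightarrow> 0" using decay_pos by real_asymp
    then have "(\<lambda>n. 2 * ((\<alpha>2 - \<alpha>1) * (K * exp (decay * \<bar>L\<bar>))) * exp (- decay * real n)) \<longlonglongrightarrow> 0"
      by (rule tendsto_mult_right_zero)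
    moreover have "2 * ((\<alpha>2 - \<alpha>1) * b n) = 2 * ((\<alpha>2 - \<alpha>1) * (K * exp (decay * \<bar>L\<bar>))) * exp (- decay * real n)" for n
    proof -
      have "exp (- decay * (real n - \<bar>L\<bar>)) = exp (decay * \<bar>L\<bar>) * exp (- decay * real n)"
        by (simp add: exp_add[symmetric] algebra_simps)
      then show ?thesis by (simp add: b_def)
    qed
    ultimately show ?thesis by (simp only:)
  qed
  have "(\<lambda>n. I \<alpha>1 n - I \<alpha>2 n - 2 * pi * \<i> * f z) \<longlonglongrightarrow> 0"
  proof (rule Lim_null_comparison[OF _ b0])
    obtain n0 where "\<bar>L\<bar> + 1 \<le> real n0" using real_arch_simple by blast
    then show "\<forall>\<^sub>F n in sequentially. norm (I \<alpha>1 n - I \<alpha>2 n - 2 * pi * \<i> * f z) \<le> 2 * ((\<alpha>2 - \<alpha>1) * b n)"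
      by (intro eventually_sequentiallyI[of n0] ev) (metis of_nat_le_iff order_trans)
  qed
  moreover have I_lim: "I \<gamma> \<longlonglongrightarrow> ray_transform f \<gamma> z" if "\<gamma> \<in> {\<alpha>1, \<alpha>2}" for \<gamma>
    unfolding I_def ray_transform_def F_def[symmetric]
  proof (rule tendsto_LINT_symmetric_interval)
    have "0 < \<bar>Im \<zeta> - \<gamma>\<bar>" "\<bar>Im \<zeta> - \<gamma>\<bar> < pi" using that assms angle by auto
    then have "sin (Im \<zeta> - \<gamma>) \<noteq> 0"
      by (rule sin_nonzero)
    then show "integrable lborel (\<lambda>t. F (Complex t \<gamma>))"
      unfolding F_def z_def using that assms by (intro ray_integrable) auto
  qed (use contray that in auto)
  then have "(\<lambda>n. I \<alpha>1 n - I \<alpha>2 n - 2 * pi * \<i> * f z)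
      \<longlonglongrightarrow> ray_transform f \<alpha>1 z - ray_transform f \<alpha>2 z - 2 * pi * \<i> * f z"
    by (intro tendsto_intros) auto
  ultimately show ?thesis
    using LIMSEQ_unique by (fastforce simp: z_def)
qed

end

subsection \<open>Decomposition on a wedge\<close>

lemma sin_ge_sin:
  assumes "0 \<le> x" "x \<le> y" "y \<le> pi - x"
  shows "sin x \<le> sin y"
proof (cases "y \<le> pi / 2")
  case True
  then show ?thesis using assms by (intro sin_monotone_2pi_le) auto
next
  case False
  then have "sin x \<le> sin (pi - y)" using assms by (intro sin_monotone_2pi_le) auto
  then show ?thesis by simp
qed

text \<open>Another logarithm of the same point has its imaginary part off by a multiple of
  \<open>2 * pi\<close>; the two bounds keep all of these outside the strip.\<close>

lemma exp_mem_wedge_iff: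
  assumes "Im \<omega> - \<gamma> \<le> 2 * pi" "\<delta> - Im \<omega> \<le> 2 * pi"
  shows "exp \<omega> \<in> wedge \<gamma> \<delta> \<longleftrightarrow> \<gamma> < Im \<omega> \<and> Im \<omega> < \<delta>"
proof
  assume "exp \<omega> \<in> wedge \<gamma> \<delta>"
  then obtain \<omega>' where w: "exp \<omega> = exp \<omega>'" "\<gamma> < Im \<omega>'" "Im \<omega>' < \<delta>" by (rule wedgeE)
  have "\<omega> = \<omega>'"
  proof (rule exp_complex_eqI)
    show "\<bar>Im \<omega> - Im \<omega>'\<bar> < 2 * pi" using w assms by linarith
  qed (rule w(1))
  then show "\<gamma> < Im \<omega> \<and> Im \<omega> < \<delta>" using w by simp
qed (auto intro: wedgeI)

lemma powr_add_le:
  fixes a b p :: real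
  assumes "0 \<le> a" "0 \<le> b" "0 \<le> p"
  shows "(a + b) powr p \<le> 2 powr p * (a powr p + b powr p)"
proof -
  have "(a + b) powr p \<le> (2 * max a b) powr p"
    using assms by (intro powr_mono2) auto
  also have "\<dots> = 2 powr p * max a b powr p"
    using assms by (simp add: powr_mult)
  also have "\<dots> \<le> 2 powr p * (a powr p + b powr p)"
    by (intro mult_left_mono) (auto simp: max_def)
  finally show ?thesis .
qed

lemma bergman_iff:
  assumes "open S" "0 < p"
  shows "f \<in> bergman p S \<longleftrightarrow> f \<in> extensional S \<and> f holomorphic_on S \<and>
    (\<integral>\<^sup>+w. ennreal (norm (f w) powr p) * indicator S w \<partial>lborel) < \<infinity>"
proof -
  have "set_integrable lborel S (\<lambda>w. norm (f w) powr p) \<longleftrightarrow>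
      (\<integral>\<^sup>+w. ennreal (norm (f w) powr p) * indicator S w \<partial>lborel) < \<infinity>"
    if hol: "f holomorphic_on S"
  proof -
    have eq: "(\<lambda>w. indicator S w *\<^sub>R norm (f w) powr p) = (\<lambda>w. (norm (f w) * indicator S w) powr p)"
      using assms by (auto simp: fun_eq_iff split: split_indicator)
    note [measurable] = holomorphic_norm_borel_measurable[OF hol \<open>open S\<close>]
    have "(\<integral>\<^sup>+w. ennreal (norm ((norm (f w) * indicator S w) powr p)) \<partial>lborel)
        = (\<integral>\<^sup>+w. ennreal (norm (f w) powr p) * indicator S w \<partial>lborel)"
      using assms by (intro nn_integral_cong) (auto split: split_indicator)
    then show ?thesis
      unfolding set_integrable_def eq integrable_iff_bounded by simp
  qed
  then show ?thesis by (auto simp: bergman_def)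
qed

lemma nn_integral_add_powr_finite:
  fixes u v :: "'a \<Rightarrow> real"
  assumes [measurable]: "u \<in> borel_measurable M" "v \<in> borel_measurable M"
    and nonneg: "\<And>w. 0 \<le> u w" "\<And>w. 0 \<le> v w" and p: "0 \<le> p"
    and fin: "(\<integral>\<^sup>+w. ennreal (u w powr p) \<partial>M) < \<infinity>" "(\<integral>\<^sup>+w. ennreal (v w powr p) \<partial>M) < \<infinity>"
  shows "(\<integral>\<^sup>+w. ennreal ((u w + v w) powr p) \<partial>M) < \<infinity>"
proof -
  have "(\<integral>\<^sup>+w. ennreal ((u w + v w) powr p) \<partial>M)
      \<le> (\<integral>\<^sup>+w. ennreal (2 powr p) * (ennreal (u w powr p) + ennreal (v w powr p)) \<partial>M)"
    using powr_add_le[OF nonneg p]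
    by (intro nn_integral_mono) (auto intro!: ennreal_leI simp flip: ennreal_plus ennreal_mult')
  also have "\<dots> = ennreal (2 powr p) * ((\<integral>\<^sup>+w. ennreal (u w powr p) \<partial>M) + (\<integral>\<^sup>+w. ennreal (v w powr p) \<partial>M))"
    by (simp add: nn_integral_cmult nn_integral_add)
  also have "\<dots> < \<infinity>" using fin by (simp add: ennreal_mult_less_top)
  finally show ?thesis .
qed

lemma nn_integral_powr_indicator:
  fixes u :: "'a \<Rightarrow> real"
  assumes "0 < p"
  shows "(\<integral>\<^sup>+w. ennreal ((u w * indicator S w) powr p) \<partial>M) = (\<integral>\<^sup>+w. ennreal (u w powr p) * indicator S w \<partial>M)"
  using assms by (intro nn_integral_cong) (auto split: split_indicator)

section \<open>Norm bounds for the continuations and their gluing\<close>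

context wedge_function
begin

definition J where "J z = (\<integral>\<^sup>+w. ennreal (f0 w / (norm w + norm z)\<^sup>2) \<partial>lborel)"

text \<open>\<open>f0\<close> bounds the contribution of \<open>f\<close> itself to a continuation,
  and \<open>J\<close> that of the ray transforms. Only the second one goes through Schur's test;
  the first is in \<open>L^p\<close> by assumption.\<close>

lemma bergman_extension:
  assumes H: "open H" "0 \<notin> H" and holF: "F holomorphic_on H" and C: "0 < C"
    and F: "\<And>z. z \<in> H \<Longrightarrow> ennreal (norm (F z)) \<le> ennreal (f0 z) + ennreal C * J z"
  shows "restrict F H \<in> bergman p H"
proof -
  note [measurable] = holomorphic_norm_borel_measurable[OF holF H(1)]
  \<comment> \<open>\<open>J\<close> is an extended real and might be infinite at this stage.
    \<open>X\<close>, the excess of \<open>|F|\<close> over \<open>f0\<close> divided by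
    \<open>C\<close>, is a real-valued function that lies below \<open>J\<close> on
    \<open>H\<close>.\<close>
  define X where "X z = max 0 (norm (F z) * indicator H z - f0 z) / C" for z
  have X0: "0 \<le> X z" for z using C by (simp add: X_def)
  have [measurable]: "X \<in> borel_measurable borel" unfolding X_def by measurable
  have [measurable]: "H \<in> sets borel" using H by simp
  have XJ: "ennreal (X z) \<le> J z" if z: "z \<in> H" for z
  proof (cases "J z" rule: ennreal_cases)
    case (real j)
    then have "ennreal (norm (F z)) \<le> ennreal (f0 z + C * j)"
      using F[OF z] C by (simp add: ennreal_mult ennreal_plus)
    then have "norm (F z) \<le> f0 z + C * j"
      using real C by (subst (asm) ennreal_le_iff) auto
    then have "X z \<le> j" using real C z by (simp add: X_def field_simps)
    then show ?thesis using real by (simp add: ennreal_leI)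
  qed simp
  obtain K where K: "0 < K" "(\<integral>\<^sup>+z. ennreal (X z powr p) * indicator H z \<partial>lborel)
          \<le> ennreal K * (\<integral>\<^sup>+w. ennreal (f0 w powr p) \<partial>lborel)"
  proof (rule Schur_test_radial[OF p])
    fix K
    assume "0 < K" and Schur: "\<And>(h :: complex \<Rightarrow> real) X (S :: complex set). \<lbrakk>h \<in> borel_measurable borel; \<And>w. 0 \<le> h w; h 0 = 0; 0 \<notin> S;
        \<And>z. z \<in> S \<Longrightarrow> 0 \<le> X z;
        \<And>z. z \<in> S \<Longrightarrow> ennreal (X z) \<le> (\<integral>\<^sup>+w. ennreal (h w / (norm w + norm z)\<^sup>2) \<partial>lborel)\<rbrakk>
      \<Longrightarrow> (\<integral>\<^sup>+z. ennreal (X z powr p) * indicator S z \<partial>lborel)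
          \<le> ennreal K * (\<integral>\<^sup>+w. ennreal (h w powr p) \<partial>lborel)"
    show thesis
    proof (rule that[OF \<open>0 < K\<close> Schur])
      show "ennreal (X z) \<le> (\<integral>\<^sup>+w. ennreal (f0 w / (norm w + norm z)\<^sup>2) \<partial>lborel)" if "z \<in> H" for z
        using XJ[OF that] by (simp only: J_def)
    qed (use H X0 in \<open>auto simp: f0_def[of 0] zero_notin_wedge\<close>)
  qed
  then have "(\<integral>\<^sup>+z. ennreal ((X z * indicator H z) powr p) \<partial>lborel) < \<infinity>"
    using f0_fin p by (simp add: nn_integral_powr_indicator ennreal_mult_less_top le_less_trans)
  then have "ennreal (C powr p) * (\<integral>\<^sup>+z. ennreal ((X z * indicator H z) powr p) \<partial>lborel) < \<infinity>"
    by (simp add: ennreal_mult_less_top)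
  also have "ennreal (C powr p) * (\<integral>\<^sup>+z. ennreal ((X z * indicator H z) powr p) \<partial>lborel)
      = (\<integral>\<^sup>+z. ennreal ((C * (X z * indicator H z)) powr p) \<partial>lborel)"
    using C X0 by (subst nn_integral_cmult[symmetric]) (auto simp: powr_mult ennreal_mult')
  finally have "(\<integral>\<^sup>+z. ennreal ((f0 z + C * (X z * indicator H z)) powr p) \<partial>lborel) < \<infinity>"
    using p X0 C f0_fin by (intro nn_integral_add_powr_finite) auto
  moreover have "(\<integral>\<^sup>+z. ennreal (norm (restrict F H z) powr p) * indicator H z \<partial>lborel)
      \<le> (\<integral>\<^sup>+z. ennreal ((f0 z + C * (X z * indicator H z)) powr p) \<partial>lborel)"
  proof (intro nn_integral_mono)
    fix z
    have "norm (F z) \<le> f0 z + C * X z" if "z \<in> H"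
      using that C by (simp add: X_def)
    then show "ennreal (norm (restrict F H z) powr p) * indicator H z
        \<le> ennreal ((f0 z + C * (X z * indicator H z)) powr p)"
      using p by (cases "z \<in> H") (auto intro!: ennreal_leI powr_mono2)
  qed
  ultimately have "(\<integral>\<^sup>+z. ennreal (norm (restrict F H z) powr p) * indicator H z \<partial>lborel) < \<infinity>"
    by (rule le_less_trans[rotated])
  moreover have "restrict F H holomorphic_on H"
    using holF by (rule holomorphic_transform) simp
  ultimately show ?thesis
    using H p by (simp add: bergman_iff)
qed

text \<open>Within half a turn on either side of the ray the sine of the angle to it has no
  zero.\<close>

lemma ray_transform_holomorphic:
  assumes \<gamma>: "\<alpha> < \<gamma>" "\<gamma> < \<beta>"
    and S: "S \<subseteq> wedge \<gamma> (\<gamma> + pi) \<or> S \<subseteq> wedge (\<gamma> - pi) \<gamma>"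
  shows "ray_transform f \<gamma> holomorphic_on S"
proof -
  have "ray_transform f \<gamma> field_differentiable at z" if "z \<in> S" for z
  proof -
    obtain \<zeta> where "z = exp \<zeta>" "0 < \<bar>Im \<zeta> - \<gamma>\<bar>" "\<bar>Im \<zeta> - \<gamma>\<bar> < pi"
      using S \<open>z \<in> S\<close> by (fastforce elim!: wedgeE)
    moreover from this have "sin (Im \<zeta> - \<gamma>) \<noteq> 0"
      by (intro sin_nonzero)
    ultimately show ?thesis using ray_transform_differentiable[OF \<gamma>] by simp
  qed
  then show ?thesis
    by (auto simp: holomorphic_on_def intro: field_differentiable_at_within)
qed

lemma half_plane_decomposition:
  obtains f1 f2 where "f1 \<in> bergman p (wedge \<alpha> (\<alpha> + pi))" "f2 \<in> bergman p (wedge (\<beta> - pi) \<beta>)"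
    "\<And>z. z \<in> wedge \<alpha> \<beta> \<Longrightarrow> f z = f1 z + f2 z"
proof -
  \<comment> \<open>The sector is cut into six equal angles, with the rays after two and four of
    them and the seam after three. Each transform is then estimated only at angles between
    \<open>\<theta>\<close> and \<open>pi - \<theta>\<close> from its ray, which keeps clear of the
    reflected ray as well.\<close>
  define \<theta> where "\<theta> = (\<beta> - \<alpha>) / 6"
  have \<theta>: "0 < \<theta>" "6 * \<theta> < pi" "\<beta> = \<alpha> + 6 * \<theta>"
    using angle by (simp_all add: \<theta>_def field_simps)
  define \<alpha>1 where "\<alpha>1 = \<alpha> + 2 * \<theta>"
  define \<alpha>2 where "\<alpha>2 = \<alpha> + 4 * \<theta>"
  note a_defs = \<alpha>1_def \<alpha>2_def \<theta>(3)
  define \<kappa> where "\<kappa> = 1 / (2 * pi * \<i>)"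
  define I1 where "I1 z = \<kappa> * ray_transform f \<alpha>1 z" for z
  define I2 where "I2 z = \<kappa> * ray_transform f \<alpha>2 z" for z
  have Cauchy: "f (exp \<omega>) = I1 (exp \<omega>) - I2 (exp \<omega>)" if "\<alpha>1 < Im \<omega>" "Im \<omega> < \<alpha>2" for \<omega>
  proof -
    have "I1 (exp \<omega>) - I2 (exp \<omega>) = \<kappa> * (2 * pi * \<i> * f (exp \<omega>))"
      unfolding I1_def I2_def right_diff_distrib[symmetric] using that \<theta>
      by (subst ray_transform_Cauchy) (simp_all add: a_defs)
    then show ?thesis by (simp add: \<kappa>_def)
  qed
  define \<delta> where "\<delta> = sin \<theta>"
  have \<delta>: "0 < \<delta>" using \<theta> by (simp add: \<delta>_def sin_gt_zero)
  have sin1: "\<delta> \<le> \<bar>sin (x - y)\<bar>" if "\<theta> \<le> \<bar>x - y\<bar>" "\<bar>x - y\<bar> \<le> pi - \<theta>" for x y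
  proof -
    have "\<delta> \<le> sin \<bar>x - y\<bar>" unfolding \<delta>_def using that \<theta> by (intro sin_ge_sin) auto
    then show ?thesis using sin_abs_le by (rule order_trans)
  qed
  have norm_\<kappa>: "norm \<kappa> \<le> 1" using pi_gt3 by (simp add: \<kappa>_def norm_divide norm_mult)
  have scaled: "ennreal (norm (\<kappa> * x)) \<le> ennreal (norm x)" for x
    using mult_right_mono[OF norm_\<kappa>, of "norm x"] by (intro ennreal_leI) (simp add: norm_mult)
  have in\<alpha>1: "\<alpha> < \<alpha>1" "\<alpha>1 < \<beta>" and in\<alpha>2: "\<alpha> < \<alpha>2" "\<alpha>2 < \<beta>"
    using \<theta> by (simp_all add: a_defs)
  obtain C1 where C1: "0 < C1" "\<And>\<zeta>. \<delta> \<le> \<bar>sin (Im \<zeta> - \<alpha>1)\<bar> \<Longrightarrow>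
      ennreal (norm (ray_transform f \<alpha>1 (exp \<zeta>))) \<le> ennreal C1 * J (exp \<zeta>)"
    unfolding J_def by (rule ray_transform_le[OF in\<alpha>1 \<delta>]) blast
  obtain C2 where C2: "0 < C2" "\<And>\<zeta>. \<delta> \<le> \<bar>sin (Im \<zeta> - \<alpha>2)\<bar> \<Longrightarrow>
      ennreal (norm (ray_transform f \<alpha>2 (exp \<zeta>))) \<le> ennreal C2 * J (exp \<zeta>)"
    unfolding J_def by (rule ray_transform_le[OF in\<alpha>2 \<delta>]) blast
  define C where "C = C1 + C2"
  have C: "0 < C" using C1 C2 by (simp add: C_def)
  have I1_le: "ennreal (norm (I1 (exp \<omega>))) \<le> ennreal C * J (exp \<omega>)"
    if "\<theta> \<le> \<bar>Im \<omega> - \<alpha>1\<bar>" "\<bar>Im \<omega> - \<alpha>1\<bar> \<le> pi - \<theta>" for \<omega>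
  proof -
    have "ennreal (norm (I1 (exp \<omega>))) \<le> ennreal C1 * J (exp \<omega>)"
      unfolding I1_def using scaled C1(2)[OF sin1[OF that]] by (rule order_trans)
    also have "\<dots> \<le> ennreal C * J (exp \<omega>)"
      using C2 by (intro mult_right_mono ennreal_leI) (auto simp: C_def)
    finally show ?thesis .
  qed
  have I2_le: "ennreal (norm (I2 (exp \<omega>))) \<le> ennreal C * J (exp \<omega>)"
    if "\<theta> \<le> \<bar>Im \<omega> - \<alpha>2\<bar>" "\<bar>Im \<omega> - \<alpha>2\<bar> \<le> pi - \<theta>" for \<omega>
  proof -
    have "ennreal (norm (I2 (exp \<omega>))) \<le> ennreal C2 * J (exp \<omega>)"
      unfolding I2_def using scaled C2(2)[OF sin1[OF that]] by (rule order_trans)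
    also have "\<dots> \<le> ennreal C * J (exp \<omega>)"
      using C1 by (intro mult_right_mono ennreal_leI) (auto simp: C_def)
    finally show ?thesis .
  qed
  have f_plus_le: "ennreal (norm (f z + x)) \<le> ennreal (f0 z) + ennreal C * J z"
    if "z \<in> wedge \<alpha> \<beta>" "ennreal (norm x) \<le> ennreal C * J z" for z x
  proof -
    have "ennreal (norm (f z + x)) \<le> ennreal (norm (f z)) + ennreal (norm x)"
      using norm_triangle_ineq[of "f z" x] by (simp add: ennreal_leI flip: ennreal_plus)
    also have "\<dots> \<le> ennreal (f0 z) + ennreal C * J z"
      using that by (intro add_mono) (auto simp: f0_def)
    finally show ?thesis .
  qed

  define U1 where "U1 = wedge \<alpha> \<alpha>2"
  define V1 where "V1 = wedge \<alpha>1 (\<alpha> + pi)"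
  define U2 where "U2 = wedge \<alpha>1 \<beta>"
  define V2 where "V2 = wedge (\<beta> - pi) \<alpha>2"
  \<comment> \<open>Between the two rays Cauchy's formula says that \<open>f + I2\<close> agrees
    with \<open>I1\<close>, and likewise \<open>f - I1\<close> with \<open>- I2\<close>. Either
    branch may be used there, for holomorphy as well as for the estimate.\<close>
  define F1 where "F1 z = (if z \<in> U1 then f z + I2 z else I1 z)" for z
  define F2 where "F2 z = (if z \<in> U2 then f z + - I1 z else - I2 z)" for z
  have U1_iff: "exp \<omega> \<in> U1 \<longleftrightarrow> Im \<omega> < \<alpha>2" if "\<alpha> < Im \<omega>" "Im \<omega> < \<alpha> + pi" for \<omega>
    unfolding U1_def using that \<theta> by (subst exp_mem_wedge_iff) (auto simp: a_defs)
  have U2_iff: "exp \<omega> \<in> U2 \<longleftrightarrow> \<alpha>1 < Im \<omega>" if "\<beta> - pi < Im \<omega>" "Im \<omega> < \<beta>" for \<omega>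
    unfolding U2_def using that \<theta> by (subst exp_mem_wedge_iff) (auto simp: a_defs)
  have F1_right: "F1 (exp \<omega>) = I1 (exp \<omega>)" if "\<alpha>1 < Im \<omega>" "Im \<omega> < \<alpha> + pi" for \<omega>
    using that U1_iff[of \<omega>] Cauchy[of \<omega>] \<theta> by (auto simp: F1_def a_defs)
  have F2_right: "F2 (exp \<omega>) = - I2 (exp \<omega>)" if "\<beta> - pi < Im \<omega>" "Im \<omega> < \<alpha>2" for \<omega>
    using that U2_iff[of \<omega>] Cauchy[of \<omega>] \<theta> by (auto simp: F2_def a_defs)

  have hol1: "F1 holomorphic_on wedge \<alpha> (\<alpha> + pi)"
  proof -
    have "(\<lambda>z. f z + I2 z) holomorphic_on U1"
      unfolding I2_def U1_def
      by (intro holomorphic_intros holomorphic_on_subset[OF hol] ray_transform_holomorphic disjI2 wedge_mono)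
         (use \<theta> in \<open>auto simp: a_defs\<close>)
    then have "F1 holomorphic_on U1" by (rule holomorphic_transform) (simp add: F1_def)
    moreover have "I1 holomorphic_on V1"
      unfolding I1_def V1_def
      by (intro holomorphic_intros ray_transform_holomorphic disjI1 wedge_mono)
         (use \<theta> in \<open>auto simp: a_defs\<close>)
    then have "F1 holomorphic_on V1"
      by (rule holomorphic_transform) (auto simp: V1_def F1_right elim!: wedgeE)
    ultimately have "F1 holomorphic_on (U1 \<union> V1)"
      by (intro holomorphic_on_Un) (auto simp: U1_def V1_def open_wedge)
    moreover have "wedge \<alpha> (\<alpha> + pi) \<subseteq> U1 \<union> V1"
    proof
      fix z assume "z \<in> wedge \<alpha> (\<alpha> + pi)"
      then obtain \<omega> where w: "z = exp \<omega>" "\<alpha> < Im \<omega>" "Im \<omega> < \<alpha> + pi" by (rule wedgeE)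
      show "z \<in> U1 \<union> V1"
      proof (cases "Im \<omega> < \<alpha>2")
        case True
        then show ?thesis using w by (auto simp: U1_def intro!: wedgeI)
      next
        case False
        then have "\<alpha>1 < Im \<omega>" using \<theta> by (simp add: a_defs)
        then show ?thesis using w by (auto simp: V1_def intro!: wedgeI)
      qed
    qed
    ultimately show ?thesis by (rule holomorphic_on_subset)
  qed
  have hol2: "F2 holomorphic_on wedge (\<beta> - pi) \<beta>"
  proof -
    have "(\<lambda>z. f z + - I1 z) holomorphic_on U2"
      unfolding I1_def U2_def
      by (intro holomorphic_intros holomorphic_on_subset[OF hol] ray_transform_holomorphic disjI1 wedge_mono)
         (use \<theta> in \<open>auto simp: a_defs\<close>)
    then have "F2 holomorphic_on U2" by (rule holomorphic_transform) (simp add: F2_def)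
    moreover have "(\<lambda>z. - I2 z) holomorphic_on V2"
      unfolding I2_def V2_def
      by (intro holomorphic_intros ray_transform_holomorphic disjI2 wedge_mono)
         (use \<theta> in \<open>auto simp: a_defs\<close>)
    then have "F2 holomorphic_on V2"
      by (rule holomorphic_transform) (auto simp: V2_def F2_right elim!: wedgeE)
    ultimately have "F2 holomorphic_on (U2 \<union> V2)"
      by (intro holomorphic_on_Un) (auto simp: U2_def V2_def open_wedge)
    moreover have "wedge (\<beta> - pi) \<beta> \<subseteq> U2 \<union> V2"
    proof
      fix z assume "z \<in> wedge (\<beta> - pi) \<beta>"
      then obtain \<omega> where w: "z = exp \<omega>" "\<beta> - pi < Im \<omega>" "Im \<omega> < \<beta>" by (rule wedgeE)
      show "z \<in> U2 \<union> V2"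
      proof (cases "\<alpha>1 < Im \<omega>")
        case True
        then show ?thesis using w by (auto simp: U2_def intro!: wedgeI)
      next
        case False
        then have "Im \<omega> < \<alpha>2" using \<theta> by (simp add: a_defs)
        then show ?thesis using w by (auto simp: V2_def intro!: wedgeI)
      qed
    qed
    ultimately show ?thesis by (rule holomorphic_on_subset)
  qed

  have mono: "x \<le> ennreal (f0 z) + ennreal C * J z" if "x \<le> ennreal C * J z" for x z
    using that by (rule order_trans) simp
  have "restrict F1 (wedge \<alpha> (\<alpha> + pi)) \<in> bergman p (wedge \<alpha> (\<alpha> + pi))"
  proof (rule bergman_extension[OF open_wedge zero_notin_wedge hol1 C])
    fix z assume "z \<in> wedge \<alpha> (\<alpha> + pi)"
    then obtain \<omega> where w: "z = exp \<omega>" "\<alpha> < Im \<omega>" "Im \<omega> < \<alpha> + pi" by (rule wedgeE)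
    show "ennreal (norm (F1 z)) \<le> ennreal (f0 z) + ennreal C * J z"
    \<comment> \<open>The estimate changes branch on the bisector rather than on the edge of
      \<open>U1\<close>, which is the ray of \<open>I2\<close> itself and leaves no angular
      margin.\<close>
    proof (cases "\<alpha> + 3 * \<theta> \<le> Im \<omega>")
      case True
      then have "F1 z = I1 z" using w F1_right[of \<omega>] \<theta> by (simp add: a_defs)
      then show ?thesis
        using I1_le[of \<omega>] w True \<theta> by (intro mono) (simp add: a_defs)
    next
      case False
      then have "F1 z = f z + I2 z" using w U1_iff[of \<omega>] \<theta> by (simp add: F1_def a_defs)
      moreover have "z \<in> wedge \<alpha> \<beta>" using w False \<theta> by (auto simp: a_defs intro!: wedgeI)
      moreover have "ennreal (norm (I2 z)) \<le> ennreal C * J z"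
        unfolding w(1) by (rule I2_le) (use w False \<theta> in \<open>auto simp: a_defs\<close>)
      ultimately show ?thesis using f_plus_le by simp
    qed
  qed
  moreover have "restrict F2 (wedge (\<beta> - pi) \<beta>) \<in> bergman p (wedge (\<beta> - pi) \<beta>)"
  proof (rule bergman_extension[OF open_wedge zero_notin_wedge hol2 C])
    fix z assume "z \<in> wedge (\<beta> - pi) \<beta>"
    then obtain \<omega> where w: "z = exp \<omega>" "\<beta> - pi < Im \<omega>" "Im \<omega> < \<beta>" by (rule wedgeE)
    show "ennreal (norm (F2 z)) \<le> ennreal (f0 z) + ennreal C * J z"
    proof (cases "Im \<omega> \<le> \<alpha> + 3 * \<theta>")
      case True
      then have "F2 z = - I2 z" using w F2_right[of \<omega>] \<theta> by (simp add: a_defs)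
      moreover have "ennreal (norm (I2 z)) \<le> ennreal C * J z"
        unfolding w(1) by (rule I2_le) (use w True \<theta> in \<open>auto simp: a_defs\<close>)
      ultimately show ?thesis by (intro mono) simp
    next
      case False
      then have "F2 z = f z + - I1 z" using w U2_iff[of \<omega>] \<theta> by (simp add: F2_def a_defs)
      moreover have "z \<in> wedge \<alpha> \<beta>" using w False \<theta> by (auto simp: a_defs intro!: wedgeI)
      moreover have "ennreal (norm (- I1 z)) \<le> ennreal C * J z"
        unfolding norm_minus_cancel w(1) by (rule I1_le) (use w False \<theta> in \<open>auto simp: a_defs\<close>)
      ultimately show ?thesis using f_plus_le[of z "- I1 z"] by simp
    qed
  qed
  moreover have "f z = restrict F1 (wedge \<alpha> (\<alpha> + pi)) z + restrict F2 (wedge (\<beta> - pi) \<beta>) z"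
    if z: "z \<in> wedge \<alpha> \<beta>" for z
  proof -
    from z obtain \<omega> where w: "z = exp \<omega>" "\<alpha> < Im \<omega>" "Im \<omega> < \<beta>" by (rule wedgeE)
    have w': "Im \<omega> < \<alpha> + pi" "\<beta> - pi < Im \<omega>" using w \<theta> by auto
    have mem: "z \<in> wedge \<alpha> (\<alpha> + pi)" "z \<in> wedge (\<beta> - pi) \<beta>"
      using w w' by (auto intro!: wedgeI)
    have "f z = F1 z + F2 z"
    \<comment> \<open>In each case one of the two functions is a bare transform and the other is
      \<open>f\<close> minus it.\<close>
    proof (cases "\<alpha>1 < Im \<omega>")
      case True
      then have "F1 z = I1 z" "F2 z = f z + - I1 z"
        using w w' F1_right[of \<omega>] U2_iff[of \<omega>] by (auto simp: F2_def)
      then show ?thesis by simp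
    next
      case False
      then have "Im \<omega> < \<alpha>2" using \<theta> by (simp add: a_defs)
      then have "F1 z = f z + I2 z" "F2 z = - I2 z"
        using w w' F2_right[of \<omega>] U1_iff[of \<omega>] by (auto simp: F1_def)
      then show ?thesis by simp
    qed
    then show ?thesis using mem by simp
  qed
  ultimately show thesis by (rule that)
qed

end

subsection \<open>Sectors and half planes\<close>

lemma bergman_translation:
  assumes "f \<in> bergman p ((+) c ` S)" "open S" "0 < p"
  shows "restrict (\<lambda>z. f (c + z)) S \<in> bergman p S"
proof -
  have T: "open ((+) c ` S)" using assms(2) by (rule open_translation)
  have f: "f holomorphic_on ((+) c ` S)"
    "(\<integral>\<^sup>+w. ennreal (norm (f w) powr p) * indicator ((+) c ` S) w \<partial>lborel) < \<infinity>"
    using assms(1) bergman_iff[OF T assms(3)] by auto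
  note [measurable] = holomorphic_norm_borel_measurable[OF f(1) T]
  have "(\<lambda>z. f (c + z)) holomorphic_on S"
  proof -
    have "f \<circ> (\<lambda>z. c + z) holomorphic_on S"
      using f(1) by (intro holomorphic_on_compose holomorphic_intros) simp
    then show ?thesis by (simp add: o_def)
  qed
  then have hol: "restrict (\<lambda>z. f (c + z)) S holomorphic_on S"
    by (rule holomorphic_transform) simp
  have "(\<integral>\<^sup>+w. ennreal (norm (restrict (\<lambda>z. f (c + z)) S w) powr p) * indicator S w \<partial>lborel)
      = (\<integral>\<^sup>+w. ennreal ((norm (f (c + w)) * indicator ((+) c ` S) (c + w)) powr p) \<partial>lborel)"
    using assms(3) by (intro nn_integral_cong) (auto split: split_indicator)
  also have "\<dots> = (\<integral>\<^sup>+w. ennreal ((norm (f w) * indicator ((+) c ` S) w) powr p) \<partial>lborel)"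
    by (rule nn_integral_translation[where f = "\<lambda>w. ennreal ((norm (f w) * indicator ((+) c ` S) w) powr p)"]) measurable
  also have "\<dots> < \<infinity>"
    using f(2) assms(3) by (simp add: nn_integral_powr_indicator)
  finally show ?thesis
    using hol assms by (simp add: bergman_iff)
qed

text \<open>This gives the inclusion of the sum in the Bergman space of the sector; finiteness comes
  from \<open>(a + b)^p <= 2^p * (a^p + b^p)\<close>.\<close>

lemma bergman_add_restrict:
  assumes f: "f \<in> bergman p A" and g: "g \<in> bergman p B"
    and S: "open S" "S \<subseteq> A" "S \<subseteq> B" and AB: "open A" "open B" and p: "0 < p"
  shows "restrict (\<lambda>z. f z + g z) S \<in> bergman p S"
proof -
  have fg: "f holomorphic_on A" "g holomorphic_on B"
    "(\<integral>\<^sup>+w. ennreal (norm (f w) powr p) * indicator A w \<partial>lborel) < \<infinity>"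
    "(\<integral>\<^sup>+w. ennreal (norm (g w) powr p) * indicator B w \<partial>lborel) < \<infinity>"
    using f g AB p by (auto simp: bergman_iff)
  note [measurable] = holomorphic_norm_borel_measurable[OF fg(1) AB(1)]
    holomorphic_norm_borel_measurable[OF fg(2) AB(2)]
  have "(\<lambda>z. f z + g z) holomorphic_on S"
    using fg S by (auto intro!: holomorphic_intros intro: holomorphic_on_subset)
  then have hol: "restrict (\<lambda>z. f z + g z) S holomorphic_on S"
    by (rule holomorphic_transform) simp
  have "(\<integral>\<^sup>+w. ennreal (norm (restrict (\<lambda>z. f z + g z) S w) powr p) * indicator S w \<partial>lborel)
      \<le> (\<integral>\<^sup>+w. ennreal ((norm (f w) * indicator A w + norm (g w) * indicator B w) powr p) \<partial>lborel)"
  proof (intro nn_integral_mono)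
    fix w
    show "ennreal (norm (restrict (\<lambda>z. f z + g z) S w) powr p) * indicator S w
        \<le> ennreal ((norm (f w) * indicator A w + norm (g w) * indicator B w) powr p)"
      using S p by (cases "w \<in> S") (auto intro!: ennreal_leI powr_mono2 norm_triangle_ineq simp: subset_iff)
  qed
  also have "\<dots> < \<infinity>"
    using fg p by (intro nn_integral_add_powr_finite) (auto simp: nn_integral_powr_indicator)
  finally show ?thesis using hol S p by (simp add: bergman_iff)
qed

lemma bergman_wedge_decomposition:
  assumes f: "f \<in> bergman p ((+) c ` wedge \<alpha> \<beta>)" and p: "1 < p" and angle: "\<alpha> < \<beta>" "\<beta> - \<alpha> < pi"
  obtains f1 f2 where "f1 \<in> bergman p ((+) c ` wedge \<alpha> (\<alpha> + pi))" "f2 \<in> bergman p ((+) c ` wedge (\<beta> - pi) \<beta>)"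
    "\<And>z. z \<in> (+) c ` wedge \<alpha> \<beta> \<Longrightarrow> f z = f1 z + f2 z"
proof -
  define g where "g = restrict (\<lambda>z. f (c + z)) (wedge \<alpha> \<beta>)"
  have "g \<in> bergman p (wedge \<alpha> \<beta>)"
    unfolding g_def using p by (intro bergman_translation f open_wedge) auto
  then interpret wedge_function g p \<alpha> \<beta>
    using p angle by unfold_locales (auto simp: bergman_iff open_wedge)
  obtain g1 g2 where g12: "g1 \<in> bergman p (wedge \<alpha> (\<alpha> + pi))" "g2 \<in> bergman p (wedge (\<beta> - pi) \<beta>)"
    "\<And>z. z \<in> wedge \<alpha> \<beta> \<Longrightarrow> g z = g1 z + g2 z"
    by (rule half_plane_decomposition) blast
  have shift: "restrict (\<lambda>z. h (- c + z)) ((+) c ` W) \<in> bergman p ((+) c ` W)"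
    if "h \<in> bergman p W" "open W" for h W
  proof (rule bergman_translation)
    show "h \<in> bergman p ((+) (- c) ` (+) c ` W)" using that by (simp add: image_image)
  qed (use that p in \<open>auto intro: open_translation\<close>)
  show thesis
  proof (rule that[OF shift[OF g12(1) open_wedge] shift[OF g12(2) open_wedge]])
    fix z assume "z \<in> (+) c ` wedge \<alpha> \<beta>"
    then obtain w where w: "z = c + w" "w \<in> wedge \<alpha> \<beta>" by auto
    have "w \<in> wedge \<alpha> (\<alpha> + pi)" "w \<in> wedge (\<beta> - pi) \<beta>"
      using w(2) wedge_mono[of \<alpha> \<alpha> \<beta> "\<alpha> + pi"] wedge_mono[of "\<beta> - pi" \<alpha> \<beta> \<beta>] angle by auto
    then show "f z = restrict (\<lambda>z. g1 (- c + z)) ((+) c ` wedge \<alpha> (\<alpha> + pi)) z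
        + restrict (\<lambda>z. g2 (- c + z)) ((+) c ` wedge (\<beta> - pi) \<beta>) z"
      using g12(3)[OF w(2)] w by (simp add: g_def)
  qed
qed

section \<open>Recovering the half planes from their sector\<close>

lemma sector_eq_wedge:
  assumes "sector S"
  obtains c \<alpha> \<beta> where "\<alpha> < \<beta>" "\<beta> - \<alpha> < pi" "S = (+) c ` wedge \<alpha> \<beta>"
proof -
  obtain c \<phi> \<theta> where \<theta>: "0 < \<theta>" "\<theta> < pi"
    and S: "S = (\<lambda>z. c + cis \<phi> * z) ` {z. 0 < Arg z \<and> Arg z < \<theta>}"
    using assms by (auto simp: sector_def)
  have "{z. 0 < Arg z \<and> Arg z < \<theta>} = wedge 0 \<theta>"
  proof (intro equalityI subsetI)
    fix z assume z: "z \<in> {z. 0 < Arg z \<and> Arg z < \<theta>}"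
    \<comment> \<open>Since \<open>Arg 0 = 0\<close>, the strict lower bound excludes the apex and
      the logarithm is available.\<close>
    then have "z \<noteq> 0" by (auto simp: Arg_def)
    then have "z = exp (Ln z)" "Im (Ln z) = Arg z" by (simp_all add: Arg_eq_Im_Ln)
    then show "z \<in> wedge 0 \<theta>" using z by (metis (mono_tags, lifting) mem_Collect_eq wedgeI)
  next
    fix z assume "z \<in> wedge 0 \<theta>"
    then obtain \<omega> where w: "z = exp \<omega>" "0 < Im \<omega>" "Im \<omega> < \<theta>" by (rule wedgeE)
    then have "Arg z = Im \<omega>" using \<theta> by (simp add: Arg_eq_Im_Ln Ln_exp)
    then show "z \<in> {z. 0 < Arg z \<and> Arg z < \<theta>}" using w by simp
  qed
  moreover have "(\<lambda>z. cis \<phi> * z) ` wedge 0 \<theta> = wedge \<phi> (\<phi> + \<theta>)"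
  proof (intro equalityI subsetI)
    fix z assume "z \<in> (\<lambda>z. cis \<phi> * z) ` wedge 0 \<theta>"
    then show "z \<in> wedge \<phi> (\<phi> + \<theta>)"
      by (auto simp: cis_conv_exp elim!: wedgeE intro!: wedgeI simp flip: exp_add)
  next
    fix z assume "z \<in> wedge \<phi> (\<phi> + \<theta>)"
    then obtain \<omega> where w: "z = exp \<omega>" "\<phi> < Im \<omega>" "Im \<omega> < \<phi> + \<theta>" by (rule wedgeE)
    then have "z = cis \<phi> * exp (\<omega> - \<i> * \<phi>)" by (simp add: cis_conv_exp flip: exp_add)
    moreover have "exp (\<omega> - \<i> * \<phi>) \<in> wedge 0 \<theta>" using w by (intro wedgeI) auto
    ultimately show "z \<in> (\<lambda>z. cis \<phi> * z) ` wedge 0 \<theta>" by blast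
  qed
  ultimately have "S = (+) c ` wedge \<phi> (\<phi> + \<theta>)"
    unfolding S by (metis (no_types, lifting) image_cong image_image)
  then show thesis using that[of \<phi> "\<phi> + \<theta>"] \<theta> by auto
qed

text \<open>Two distinct boundary points on the line through \<open>c\<close> in direction
  \<open>cis \<psi>\<close> force \<open>a\<close> to be orthogonal to that direction, so
  \<open>a\<close> is a real multiple \<open>k\<close> of \<open>\<i> * cis \<psi>\<close>; the sign
  of \<open>k\<close> selects the side.\<close>

lemma half_plane_eq_wedge:
  assumes "a \<noteq> 0" and xy: "x \<noteq> y" "a \<bullet> (c + of_real x * cis \<psi>) = b" "a \<bullet> (c + of_real y * cis \<psi>) = b"
  shows "{z. a \<bullet> z > b} = (+) c ` wedge \<psi> (\<psi> + pi) \<or> {z. a \<bullet> z > b} = (+) c ` wedge (\<psi> - pi) \<psi>"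
proof -
  define u where "u = cis \<psi>"
  have lin: "a \<bullet> (c + of_real r * u) = a \<bullet> c + r * (a \<bullet> u)" for r
    by (simp add: inner_add_right scaleR_conv_of_real[symmetric])
  have "a \<bullet> c + x * (a \<bullet> u) = b" "a \<bullet> c + y * (a \<bullet> u) = b"
    using xy(2,3) unfolding u_def[symmetric] lin by auto
  then have "x * (a \<bullet> u) = y * (a \<bullet> u)" by linarith
  then have au: "a \<bullet> u = 0" using xy by simp
  then have ac: "a \<bullet> c = b" using \<open>a \<bullet> c + x * (a \<bullet> u) = b\<close> by simp
  define k where "k = Im (a * cnj u)"
  have "Re (a * cnj u) = 0" using au by (simp add: inner_complex_def)
  then have "a * cnj u = \<i> * of_real k" by (simp add: complex_eq_iff k_def)
  then have "a * (cnj u * u) = \<i> * of_real k * u" by (simp add: mult.assoc)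
  then have a: "a = \<i> * of_real k * u" by (simp add: u_def cis_cnj cis_mult)
  then have k: "k \<noteq> 0" using assms(1) by auto
  have half: "a \<bullet> w = k * Im (w * cis (- \<psi>))" for w
    by (simp add: a u_def inner_complex_def algebra_simps)
  have mem: "z \<in> {z. a \<bullet> z > b} \<longleftrightarrow> 0 < k * Im ((z - c) * cis (- \<psi>))" for z
    unfolding half[symmetric] using ac by (simp add: inner_diff_right)
  have img: "z \<in> (+) c ` W \<longleftrightarrow> z - c \<in> W" for z and W :: "complex set"
    by (auto simp: image_iff intro!: bexI[of _ "z - c"])
  show ?thesis
  proof (cases "0 < k")
    case True
    then have "{z. a \<bullet> z > b} = (+) c ` wedge \<psi> (\<psi> + pi)"
      unfolding set_eq_iff mem img wedge_half_turn by (simp add: zero_less_mult_iff)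
    then show ?thesis ..
  next
    case False
    have "wedge (\<psi> - pi) \<psi> = {z. 0 < Im (z * cis (- (\<psi> - pi)))}"
      using wedge_half_turn[of "\<psi> - pi"] by simp
    also have "cis (- (\<psi> - pi)) = - cis (- \<psi>)" by (simp add: complex_eq_iff)
    finally have "{z. a \<bullet> z > b} = (+) c ` wedge (\<psi> - pi) \<psi>"
      unfolding set_eq_iff mem img using False k by (simp add: zero_less_mult_iff)
    then show ?thesis ..
  qed
qed

text \<open>Each point of an edge is a limit of sector points, so both inequalities hold weakly; it
  is not in the sector, so one of them is an equality. Three points on the edge and two half planes
  leave two points on the same boundary line.\<close>

lemma half_plane_boundary_ray:
  assumes a: "a1 \<noteq> 0" "a2 \<noteq> 0" and angle: "\<alpha> < \<beta>" "\<beta> - \<alpha> < pi" and \<psi>: "\<psi> = \<alpha> \<or> \<psi> = \<beta>"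
    and eq: "{z. a1 \<bullet> z > b1} \<inter> {z. a2 \<bullet> z > b2} = (+) c ` wedge \<alpha> \<beta>"
  obtains a b where "(a, b) = (a1, b1) \<or> (a, b) = (a2, b2)"
    "{z. a \<bullet> z > b} = (+) c ` wedge \<psi> (\<psi> + pi) \<or> {z. a \<bullet> z > b} = (+) c ` wedge (\<psi> - pi) \<psi>"
proof -
  define pt where "pt x \<epsilon> = c + of_real x * cis (\<psi> + \<epsilon>)" for x \<epsilon> :: real
  have pt_exp: "pt x \<epsilon> = c + exp (Complex (ln x) (\<psi> + \<epsilon>))" if "0 < x" for x \<epsilon>
    using that by (simp add: pt_def exp_eq_polar)
  have boundary: "a1 \<bullet> pt x 0 = b1 \<or> a2 \<bullet> pt x 0 = b2" if x: "0 < x" for x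
  proof -
    \<comment> \<open>The sign turns the edge into the sector: counterclockwise from
      \<open>\<alpha>\<close>, clockwise from \<open>\<beta>\<close>.\<close>
    define s where "s = (if \<psi> = \<alpha> then 1 else - 1 :: real)"
    have inside: "a1 \<bullet> pt x (s * \<epsilon>) > b1 \<and> a2 \<bullet> pt x (s * \<epsilon>) > b2" if "0 < \<epsilon>" "\<epsilon> < \<beta> - \<alpha>" for \<epsilon>
    proof -
      have "pt x (s * \<epsilon>) \<in> (+) c ` wedge \<alpha> \<beta>"
        unfolding pt_exp[OF x] using that \<psi> angle by (auto simp: s_def intro!: imageI wedgeI)
      then show ?thesis unfolding eq[symmetric] by simp
    qed
    have ev: "\<forall>\<^sub>F \<epsilon> in at_right 0. \<epsilon> < \<beta> - \<alpha> \<and> 0 < \<epsilon>"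
      using angle by (auto simp: eventually_at_right_field intro!: exI[of _ "\<beta> - \<alpha>"])
    have lim: "((\<lambda>\<epsilon>. a \<bullet> pt x (s * \<epsilon>)) \<longlongrightarrow> a \<bullet> pt x 0) (at_right 0)" for a
    proof -
      have "isCont (\<lambda>\<epsilon>. a \<bullet> pt x (s * \<epsilon>)) 0"
        unfolding pt_def cis_conv_exp by (intro continuous_intros)
      then have "((\<lambda>\<epsilon>. a \<bullet> pt x (s * \<epsilon>)) \<longlongrightarrow> a \<bullet> pt x (s * 0)) (at 0)"
        by (simp add: isCont_def)
      then show ?thesis by (auto intro: filterlim_at_split[THEN iffD1, THEN conjunct2])
    qed
    have "b1 \<le> a1 \<bullet> pt x 0"
      by (rule tendsto_lowerbound[OF lim]) (use ev inside in \<open>auto elim!: eventually_mono simp: less_imp_le\<close>)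
    moreover have "b2 \<le> a2 \<bullet> pt x 0"
      by (rule tendsto_lowerbound[OF lim]) (use ev inside in \<open>auto elim!: eventually_mono simp: less_imp_le\<close>)
    moreover have "pt x 0 \<notin> (+) c ` wedge \<alpha> \<beta>"
    proof
      assume "pt x 0 \<in> (+) c ` wedge \<alpha> \<beta>"
      then have "exp (Complex (ln x) (\<psi> + 0)) \<in> wedge \<alpha> \<beta>" unfolding pt_exp[OF x] by auto
      then show False using \<psi> angle by (subst (asm) exp_mem_wedge_iff) auto
    qed
    then have "\<not> (a1 \<bullet> pt x 0 > b1 \<and> a2 \<bullet> pt x 0 > b2)" unfolding eq[symmetric] by simp
    ultimately show ?thesis by auto
  qed
  have "(\<exists>x y. x \<noteq> y \<and> a1 \<bullet> pt x 0 = b1 \<and> a1 \<bullet> pt y 0 = b1) \<or> (\<exists>x y. x \<noteq> y \<and> a2 \<bullet> pt x 0 = b2 \<and> a2 \<bullet> pt y 0 = b2)"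
  proof -
    have "(1::real) \<noteq> 2" "(1::real) \<noteq> 3" "(2::real) \<noteq> 3" by auto
    then show ?thesis using boundary[of 1] boundary[of 2] boundary[of 3] by (metis zero_less_numeral zero_less_one)
  qed
  then show thesis
  proof
    assume "\<exists>x y. x \<noteq> y \<and> a1 \<bullet> pt x 0 = b1 \<and> a1 \<bullet> pt y 0 = b1"
    then obtain x y where xy: "x \<noteq> y" "a1 \<bullet> (c + of_real x * cis \<psi>) = b1" "a1 \<bullet> (c + of_real y * cis \<psi>) = b1"
      by (auto simp: pt_def)
    show thesis by (rule that[OF _ half_plane_eq_wedge[OF a(1) xy]]) simp
  next
    assume "\<exists>x y. x \<noteq> y \<and> a2 \<bullet> pt x 0 = b2 \<and> a2 \<bullet> pt y 0 = b2"
    then obtain x y where xy: "x \<noteq> y" "a2 \<bullet> (c + of_real x * cis \<psi>) = b2" "a2 \<bullet> (c + of_real y * cis \<psi>) = b2"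
      by (auto simp: pt_def)
    show thesis by (rule that[OF _ half_plane_eq_wedge[OF a(2) xy]]) simp
  qed
qed

text \<open>Each edge lies on the boundary line of one of the half planes, a point of the bisector
  decides the side, and the two half planes so found differ and therefore exhaust the pair. Their
  order remains open, hence the disjunction.\<close>

lemma half_planes_eq_wedges:
  assumes H: "half_plane H1" "half_plane H2" and angle: "\<alpha> < \<beta>" "\<beta> - \<alpha> < pi"
    and eq: "H1 \<inter> H2 = (+) c ` wedge \<alpha> \<beta>"
  shows "(H1 = (+) c ` wedge \<alpha> (\<alpha> + pi) \<and> H2 = (+) c ` wedge (\<beta> - pi) \<beta>)
    \<or> (H2 = (+) c ` wedge \<alpha> (\<alpha> + pi) \<and> H1 = (+) c ` wedge (\<beta> - pi) \<beta>)"
proof -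
  obtain a1 b1 a2 b2 where a: "a1 \<noteq> 0" "a2 \<noteq> 0" and H1: "H1 = {z. a1 \<bullet> z > b1}" and H2: "H2 = {z. a2 \<bullet> z > b2}"
    using H by (auto simp: half_plane_def)
  define z0 where "z0 = exp (\<i> * of_real ((\<alpha> + \<beta>) / 2))"
  have z0: "z0 \<in> wedge \<alpha> \<beta>" unfolding z0_def using angle by (intro wedgeI) auto
  then have z0H: "c + z0 \<in> H1" "c + z0 \<in> H2" using eq by blast+
  have ray: "\<exists>H \<in> {H1, H2}. H = (+) c ` wedge \<psi> (\<psi> + pi) \<or> H = (+) c ` wedge (\<psi> - pi) \<psi>"
    if \<psi>: "\<psi> = \<alpha> \<or> \<psi> = \<beta>" for \<psi>
  proof -
    obtain a b where ab: "(a, b) = (a1, b1) \<or> (a, b) = (a2, b2)"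
      "{z. a \<bullet> z > b} = (+) c ` wedge \<psi> (\<psi> + pi) \<or> {z. a \<bullet> z > b} = (+) c ` wedge (\<psi> - pi) \<psi>"
      by (rule half_plane_boundary_ray[OF a angle \<psi> eq[unfolded H1 H2]])
    have "{z. a \<bullet> z > b} \<in> {H1, H2}" using ab(1) by (auto simp: H1 H2)
    with ab(2) show ?thesis by (rule bexI)
  qed
  have z0_out: "z0 \<notin> wedge (\<alpha> - pi) \<alpha>" "z0 \<notin> wedge \<beta> (\<beta> + pi)"
    unfolding z0_def
    by (subst exp_mem_wedge_iff; use angle pi_gt_zero in \<open>auto simp: field_simps\<close>)+
  have \<alpha>: "(+) c ` wedge \<alpha> (\<alpha> + pi) \<in> {H1, H2}"
  proof -
    obtain H where H: "H \<in> {H1, H2}" "H = (+) c ` wedge \<alpha> (\<alpha> + pi) \<or> H = (+) c ` wedge (\<alpha> - pi) \<alpha>"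
      using ray[of \<alpha>] by blast
    have "c + z0 \<in> H" using H(1) z0H by blast
    moreover have "c + z0 \<notin> (+) c ` wedge (\<alpha> - pi) \<alpha>" using z0_out by auto
    ultimately have "H = (+) c ` wedge \<alpha> (\<alpha> + pi)" using H(2) by blast
    then show ?thesis using H(1) by simp
  qed
  have \<beta>: "(+) c ` wedge (\<beta> - pi) \<beta> \<in> {H1, H2}"
  proof -
    obtain H where H: "H \<in> {H1, H2}" "H = (+) c ` wedge \<beta> (\<beta> + pi) \<or> H = (+) c ` wedge (\<beta> - pi) \<beta>"
      using ray[of \<beta>] by blast
    have "c + z0 \<in> H" using H(1) z0H by blast
    moreover have "c + z0 \<notin> (+) c ` wedge \<beta> (\<beta> + pi)" using z0_out by auto
    ultimately have "H = (+) c ` wedge (\<beta> - pi) \<beta>" using H(2) by blast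
    then show ?thesis using H(1) by simp
  qed
  \<comment> \<open>This excludes that both edges belong to the same half plane: the ray of angle
    \<open>\<beta>\<close> lies inside the first and on the boundary of the second.\<close>
  have "(+) c ` wedge \<alpha> (\<alpha> + pi) \<noteq> (+) c ` wedge (\<beta> - pi) \<beta>"
  proof -
    define e where "e = exp (\<i> * of_real \<beta>)"
    have "e \<in> wedge \<alpha> (\<alpha> + pi)" "e \<notin> wedge (\<beta> - pi) \<beta>"
      unfolding e_def using angle by (subst exp_mem_wedge_iff; simp)+
    then have "c + e \<in> (+) c ` wedge \<alpha> (\<alpha> + pi)" "c + e \<notin> (+) c ` wedge (\<beta> - pi) \<beta>" by auto
    then show ?thesis by blast
  qed
  then show ?thesis using \<alpha> \<beta> by (elim insertE emptyE) simp_all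
qed

theorem theorem1p4:
  fixes p :: real and H\<^sub>1 H\<^sub>2 \<Sigma> :: "complex set"
  assumes "1 < p"
    and "half_plane H\<^sub>1" and "half_plane H\<^sub>2"
    and "\<Sigma> = H\<^sub>1 \<inter> H\<^sub>2" and "\<Sigma> \<noteq> {}" and "sector \<Sigma>"
  shows "bergman p \<Sigma> =
    {restrict (\<lambda>z. f\<^sub>1 z + f\<^sub>2 z) \<Sigma> | f\<^sub>1 f\<^sub>2. f\<^sub>1 \<in> bergman p H\<^sub>1 \<and> f\<^sub>2 \<in> bergman p H\<^sub>2}"
proof (intro equalityI subsetI)
  have op: "open H\<^sub>1" "open H\<^sub>2"
    using assms(2,3) by (auto simp: half_plane_def open_halfspace_gt)
  fix f assume "f \<in> {restrict (\<lambda>z. f\<^sub>1 z + f\<^sub>2 z) \<Sigma> | f\<^sub>1 f\<^sub>2. f\<^sub>1 \<in> bergman p H\<^sub>1 \<and> f\<^sub>2 \<in> bergman p H\<^sub>2}"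
  then show "f \<in> bergman p \<Sigma>"
    using assms(1,4) op by (auto intro!: bergman_add_restrict[where A = H\<^sub>1 and B = H\<^sub>2])
next
  fix f assume f: "f \<in> bergman p \<Sigma>"
  obtain c \<alpha> \<beta> where angle: "\<alpha> < \<beta>" "\<beta> - \<alpha> < pi" and \<Sigma>: "\<Sigma> = (+) c ` wedge \<alpha> \<beta>"
    using sector_eq_wedge[OF assms(6)] by metis
  obtain g h where gh: "g \<in> bergman p ((+) c ` wedge \<alpha> (\<alpha> + pi))" "h \<in> bergman p ((+) c ` wedge (\<beta> - pi) \<beta>)"
    "\<And>z. z \<in> (+) c ` wedge \<alpha> \<beta> \<Longrightarrow> f z = g z + h z"
    by (rule bergman_wedge_decomposition[OF f[unfolded \<Sigma>] assms(1) angle]) blast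
  have "f z = restrict (\<lambda>z. g z + h z) \<Sigma> z" for z
    using f gh(3)[of z] by (cases "z \<in> \<Sigma>") (auto simp: bergman_def extensional_def simp flip: \<Sigma>)
  \<comment> \<open>Both orders of the sum are recorded, because either of the two half planes may
    be the one bounded at angle \<open>\<alpha>\<close>.\<close>
  then have fg: "f = restrict (\<lambda>z. g z + h z) \<Sigma>" "f = restrict (\<lambda>z. h z + g z) \<Sigma>"
    by (auto simp: fun_eq_iff restrict_def add.commute)
  have "H\<^sub>1 \<inter> H\<^sub>2 = (+) c ` wedge \<alpha> \<beta>" using assms(4) \<Sigma> by simp
  then have "(g \<in> bergman p H\<^sub>1 \<and> h \<in> bergman p H\<^sub>2) \<or> (h \<in> bergman p H\<^sub>1 \<and> g \<in> bergman p H\<^sub>2)"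
    using half_planes_eq_wedges[OF assms(2,3) angle] gh(1,2) by fastforce
  with fg show "f \<in> {restrict (\<lambda>z. f\<^sub>1 z + f\<^sub>2 z) \<Sigma> | f\<^sub>1 f\<^sub>2. f\<^sub>1 \<in> bergman p H\<^sub>1 \<and> f\<^sub>2 \<in> bergman p H\<^sub>2}"
    by blast
qed

end
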